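(* Let $V$ be a left vector space over a division ring $R$ with $\dim V=n$ finite and $n\ge 3$, and let $V'$ be a vector space over a field $R'$. Let $f:\mathcal P(V)\to\mathcal P(V')$ be a non-constant PGL-mapping, and let $V_f$ be the subspace of $V'$ spanned by the image of $f$. If $\dim V_f\le n$, then $f$ is induced by a strong semilinear embedding of $V$ in $V'$, i.e. there is a strong semilinear embedding $l:V\to V'$ such that $f=\pi(l)$.
   Context: $\mathcal P(W)$ denotes the set of $1$-dimensional subspaces of a vector space $W$. $\mathrm{PGL}(W)$ is the group of all transformations of $\mathcal P(W)$ induced by linear automorphisms of $W$. A mapping $f:\mathcal P(V)\to\mathcal P(V')$ is a PGL-mapping if for every $h\in\mathrm{PGL}(V)$ there is $h'\in\mathrm{PGL}(V')$ such that $fh=h'f$. The subspace spanned by a subset $\mathcal X\subset\mathcal P(V')$ is the minimal subspace of $V'$ containing every element of $\mathcal X$. A mapping $l:V\to V'$ is semilinear if $l(x+y)=l(x)+l(y)$ for all $x,y\in V$ and there is a ring homomorphism $\sigma:R\to R'$ such that $l(ax)=\sigma(a)l(x)$ for all $a\in R$, $x\in V$ ($\sigma$ need not be surjective). A strong semilinear embedding is a semilinear injection $l:V\to V'$ which transfers any $n=\dim V$ linearly independent vectors of $V$ to linearly independent vectors of $V'$. For a semilinear injection $l$, the mapping $\pi(l):\mathcal P(V)\to\mathcal P(V')$ sends each $1$-dimensional subspace $P\subset V$ to the subspace of $V'$ spanned by $l(P)$. "Field" means commutative division ring. *)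

theory Defs
  imports Complex_Main "HOL-Library.FuncSet"
begin

text \<open>
  The library locales for modules and vector spaces require commutative scalars.  The notions
  below only assume a division ring, acting from the left; over a field they agree with the
  library ones (see the lemmas about \<^locale>\<open>vector_space\<close>).
\<close>

locale left_vector_space =
  fixes scale :: "'a::division_ring \<Rightarrow> 'b::ab_group_add \<Rightarrow> 'b"
  assumes scale_right_distrib: "scale a (x + y) = scale a x + scale a y"
    and scale_left_distrib: "scale (a + b) x = scale a x + scale b x"
    and scale_scale: "scale a (scale b x) = scale (a * b) x"
    and scale_one: "scale 1 x = x"

definition left_subspace :: "('a::division_ring \<Rightarrow> 'b::ab_group_add \<Rightarrow> 'b) \<Rightarrow> 'b set \<Rightarrow> bool" where
  "left_subspace scale W \<longleftrightarrow>
     0 \<in> W \<and> (\<forall>x\<in>W. \<forall>y\<in>W. x + y \<in> W) \<and> (\<forall>a. \<forall>x\<in>W. scale a x \<in> W)"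

definition left_span :: "('a::division_ring \<Rightarrow> 'b::ab_group_add \<Rightarrow> 'b) \<Rightarrow> 'b set \<Rightarrow> 'b set" where
  "left_span scale S = left_subspace scale hull S"

definition left_independent :: "('a::division_ring \<Rightarrow> 'b::ab_group_add \<Rightarrow> 'b) \<Rightarrow> 'b set \<Rightarrow> bool" where
  "left_independent scale S \<longleftrightarrow>
     (\<forall>T c. finite T \<longrightarrow> T \<subseteq> S \<longrightarrow> (\<Sum>x\<in>T. scale (c x) x) = 0 \<longrightarrow> (\<forall>x\<in>T. c x = 0))"

text \<open>
  Dimension is a relation, so that infinite-dimensional subspaces have no (natural) dimension
  at all, rather than the default dimension 0.
\<close>

definition has_left_dim :: "('a::division_ring \<Rightarrow> 'b::ab_group_add \<Rightarrow> 'b) \<Rightarrow> 'b set \<Rightarrow> nat \<Rightarrow> bool" where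
  "has_left_dim scale W n \<longleftrightarrow>
     (\<exists>B. finite B \<and> card B = n \<and> left_independent scale B \<and> left_span scale B = W)"

definition proj_points :: "('a::division_ring \<Rightarrow> 'b::ab_group_add \<Rightarrow> 'b) \<Rightarrow> 'b set set" where
  "proj_points scale = {P. left_subspace scale P \<and> has_left_dim scale P 1}"

definition linear_automorphism ::
    "('a::division_ring \<Rightarrow> 'b::ab_group_add \<Rightarrow> 'b) \<Rightarrow> ('b \<Rightarrow> 'b) \<Rightarrow> bool" where
  "linear_automorphism scale u \<longleftrightarrow>
     bij u \<and> (\<forall>x y. u (x + y) = u x + u y) \<and> (\<forall>a x. u (scale a x) = scale a (u x))"

definition PGL :: "('a::division_ring \<Rightarrow> 'b::ab_group_add \<Rightarrow> 'b) \<Rightarrow> ('b set \<Rightarrow> 'b set) set" where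
  "PGL scale = {\<lambda>P\<in>proj_points scale. u ` P | u. linear_automorphism scale u}"

text \<open>
  A mapping of projective spaces is a function on all sets of vectors of which only the values on
  points are relevant.
\<close>

definition PGL_mapping ::
    "('a::division_ring \<Rightarrow> 'b::ab_group_add \<Rightarrow> 'b) \<Rightarrow> ('c::division_ring \<Rightarrow> 'd::ab_group_add \<Rightarrow> 'd)
     \<Rightarrow> ('b set \<Rightarrow> 'd set) \<Rightarrow> bool" where
  "PGL_mapping scale scale' f \<longleftrightarrow>
     f \<in> proj_points scale \<rightarrow> proj_points scale' \<and>
     (\<forall>h\<in>PGL scale. \<exists>h'\<in>PGL scale'. \<forall>P\<in>proj_points scale. f (h P) = h' (f P))"

definition is_ring_hom :: "('a::ring_1 \<Rightarrow> 'c::ring_1) \<Rightarrow> bool" where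
  "is_ring_hom \<sigma> \<longleftrightarrow>
     (\<forall>a b. \<sigma> (a + b) = \<sigma> a + \<sigma> b) \<and> (\<forall>a b. \<sigma> (a * b) = \<sigma> a * \<sigma> b) \<and> \<sigma> 1 = 1"

definition semilinear ::
    "('a::division_ring \<Rightarrow> 'b::ab_group_add \<Rightarrow> 'b) \<Rightarrow> ('c::division_ring \<Rightarrow> 'd::ab_group_add \<Rightarrow> 'd)
     \<Rightarrow> ('b \<Rightarrow> 'd) \<Rightarrow> bool" where
  "semilinear scale scale' l \<longleftrightarrow>
     (\<forall>x y. l (x + y) = l x + l y) \<and>
     (\<exists>\<sigma>. is_ring_hom \<sigma> \<and> (\<forall>a x. l (scale a x) = scale' (\<sigma> a) (l x)))"

definition strong_semilinear_embedding ::
    "('a::division_ring \<Rightarrow> 'b::ab_group_add \<Rightarrow> 'b) \<Rightarrow> ('c::division_ring \<Rightarrow> 'd::ab_group_add \<Rightarrow> 'd)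
     \<Rightarrow> ('b \<Rightarrow> 'd) \<Rightarrow> bool" where
  "strong_semilinear_embedding scale scale' l \<longleftrightarrow>
     semilinear scale scale' l \<and> inj l \<and>
     (\<forall>n X. has_left_dim scale UNIV n \<longrightarrow> finite X \<longrightarrow> card X = n \<longrightarrow>
        left_independent scale X \<longrightarrow> left_independent scale' (l ` X))"

definition induced_proj_map ::
    "('c::division_ring \<Rightarrow> 'd::ab_group_add \<Rightarrow> 'd) \<Rightarrow> ('b \<Rightarrow> 'd) \<Rightarrow> 'b set \<Rightarrow> 'd set" where
  "induced_proj_map scale' l P = left_span scale' (l ` P)"

definition proj_span ::
    "('a::division_ring \<Rightarrow> 'b::ab_group_add \<Rightarrow> 'b) \<Rightarrow> 'b set set \<Rightarrow> 'b set" where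
  "proj_span scale \<X> = \<Inter>{W. left_subspace scale W \<and> (\<forall>P\<in>\<X>. P \<subseteq> W)}"

context vector_space
begin

lemma left_vector_space: "left_vector_space scale"
  by unfold_locales (simp_all add: scale_right_distrib scale_left_distrib)

lemma left_subspace_eq: "left_subspace scale = subspace"
  by (simp add: fun_eq_iff left_subspace_def subspace_def)

lemma left_span_eq: "left_span scale = span"
  by (simp add: fun_eq_iff left_span_def span_def left_subspace_eq)

lemma left_independent_eq: "left_independent scale = independent"
  by (auto simp: fun_eq_iff left_independent_def dependent_explicit)

lemma has_left_dim_imp_dim: "has_left_dim scale W n \<Longrightarrow> dim W = n"
  by (metis has_left_dim_def left_independent_eq left_span_eq dim_span dim_eq_card_independent)

end

end

theory Submission
  imports Defs
begin

text \<open>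
  Write \<open>[x]\<close> for the point spanned by a nonzero vector \<open>x\<close>, and choose a nonzero vector \<open>F x\<close> in
  \<open>f [x]\<close>.  A statement saying that some value of \<open>F\<close> lies in the span of others is invariant under the
  linear group of \<open>V\<close>, because every automorphism \<open>u\<close> of \<open>V\<close> comes with an automorphism \<open>\<phi>\<close> of \<open>V'\<close>
  such that \<open>\<phi> (F x)\<close> is a multiple of \<open>F (u x)\<close> (\<open>spanned_transport\<close>).  The linear group is
  transitive on ordered bases, here called frames, so such a statement about the members of one frame
  holds for all frames or for none.  Every step of the first half of the proof shows that a bad
  configuration, once it occurs, occurs everywhere, and then finds an automorphism of \<open>V\<close> whose
  companion \<open>\<phi>\<close> cannot exist.

  \<^item> If two distinct points had the same image, all points would have (\<open>F_inj\<close>).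

  \<^item> If three independent points had collinear images, then \<open>\<phi>\<close> for the transvection that adds
    \<open>e\<^sub>i\<close> to \<open>e\<^sub>l\<close> and fixes the rest of the frame would fix three points of the line containing
    \<open>f [e\<^sub>l]\<close>, hence \<open>f [e\<^sub>l]\<close> itself (\<open>F_triple\<close>).

  \<^item> If the images of \<open>k + 1 \<ge> 4\<close> points \<open>[e\<^sub>i]\<close> of a frame were dependent, but those of any \<open>k\<close>
    independent, then the images of one of these points and of the sum point \<open>[\<Sum> e\<^sub>i]\<close> would be two
    vectors with full support over the remaining \<open>k\<close>.  Both points are fixed when two of these \<open>k\<close>
    basis vectors are exchanged, and comparing coefficients makes them proportional
    (\<open>F_not_spanned\<close>).  So frames go to independent families (\<open>F_frame_indep\<close>).

  \<^item> The bound on the dimension of \<open>V\<^sub>f\<close> now says that the image of a frame spans \<open>V\<^sub>f\<close>.  If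
    \<open>f [e\<^sub>0 + e\<^sub>1]\<close> were not on the line through \<open>f [e\<^sub>0]\<close> and \<open>f [e\<^sub>1]\<close>, all its coefficients over the
    image of the frame would be nonzero, and the same for \<open>f [e\<^sub>0 + e\<^sub>2]\<close> and \<open>f [e\<^sub>1 + e\<^sub>2]\<close>.  The
    involution sending \<open>e\<^sub>2\<close> to \<open>- (e\<^sub>j + e\<^sub>2)\<close> for \<open>j = 0, 1\<close> fixes the first point and exchanges
    \<open>[e\<^sub>2]\<close> with \<open>[e\<^sub>j + e\<^sub>2]\<close>.  This determines \<open>f [e\<^sub>j + e\<^sub>2]\<close> by a formula that does not depend
    on \<open>j\<close>, against injectivity (\<open>F_sum_coeff_relation\<close>, \<open>F_line\<close>).

  So \<open>f\<close> preserves collinearity and the independence of triples.  The second half is the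
  corresponding form of the fundamental theorem of projective geometry: fix a point \<open>[p]\<close> and a
  hyperplane off it; for \<open>x\<close> in the hyperplane the vector \<open>l x\<close> of \<open>f [x]\<close> is singled out by
  \<open>F p + l x \<in> f [p + x]\<close>, and incidence makes \<open>l\<close> additive and semilinear (\<open>semilinear_lift\<close>).  The
  resulting ring homomorphism from \<open>R\<close> to the field \<open>R'\<close> need not be onto.  By \<open>F_frame_indep\<close>,
  the map \<open>l\<close> takes independent families of \<open>n\<close> vectors to independent ones.
\<close>

section \<open>Independent families over a division ring\<close>

context left_vector_space
begin

lemma scale_zero_left [simp]: "scale 0 x = 0"
  using scale_left_distrib[of 0 0 x] by simp

lemma scale_zero_right [simp]: "scale a 0 = 0"
  using scale_right_distrib[of a 0 0] by simp

lemma scale_minus_left: "scale (- a) x = - scale a x"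
  using scale_left_distrib[of "- a" a x] by (simp add: eq_neg_iff_add_eq_0)

lemma scale_minus_right: "scale a (- x) = - scale a x"
  using scale_right_distrib[of a "- x" x] by (simp add: eq_neg_iff_add_eq_0)

lemma scale_diff_right: "scale a (x - y) = scale a x - scale a y"
  using scale_right_distrib[of a x "- y"] by (simp add: scale_minus_right)

lemma scale_diff_left: "scale (a - b) x = scale a x - scale b x"
  using scale_left_distrib[of a "- b" x] by (simp add: scale_minus_left)

lemma scale_eq_0_iff: "scale a x = 0 \<longleftrightarrow> a = 0 \<or> x = 0"
proof
  assume "scale a x = 0"
  then have "a \<noteq> 0 \<Longrightarrow> x = 0"
    using scale_scale[of "inverse a" a x] by (simp add: scale_one)
  then show "a = 0 \<or> x = 0" by blast
qed auto

lemma scale_sum_right: "scale a (\<Sum>i\<in>K. g i) = (\<Sum>i\<in>K. scale a (g i))"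
  by (induction K rule: infinite_finite_induct) (auto simp: scale_right_distrib)

text \<open>
  Families rather than sets of vectors: the exchange arguments replace a member at a fixed index, and
  images of families under maps that may identify vectors have to be independent as families.
\<close>

definition indep :: "'i set \<Rightarrow> ('i \<Rightarrow> 'b) \<Rightarrow> bool" where
  "indep K x \<longleftrightarrow> (\<forall>c. (\<Sum>i\<in>K. scale (c i) (x i)) = 0 \<longrightarrow> (\<forall>i\<in>K. c i = 0))"

definition spanned :: "'i set \<Rightarrow> ('i \<Rightarrow> 'b) \<Rightarrow> 'b \<Rightarrow> bool" where
  "spanned K x v \<longleftrightarrow> (\<exists>c. v = (\<Sum>i\<in>K. scale (c i) (x i)))"

definition indep2 :: "'b \<Rightarrow> 'b \<Rightarrow> bool" where
  "indep2 x y \<longleftrightarrow> (\<forall>a b. scale a x + scale b y = 0 \<longrightarrow> a = 0 \<and> b = 0)"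

definition indep3 :: "'b \<Rightarrow> 'b \<Rightarrow> 'b \<Rightarrow> bool" where
  "indep3 x y z \<longleftrightarrow>
    (\<forall>a b c. scale a x + scale b y + scale c z = 0 \<longrightarrow> a = 0 \<and> b = 0 \<and> c = 0)"

lemma indep2D: "indep2 x y \<Longrightarrow> scale a x + scale b y = 0 \<Longrightarrow> a = 0 \<and> b = 0"
  by (simp add: indep2_def)

lemma indep3D: "indep3 x y z \<Longrightarrow> scale a x + scale b y + scale c z = 0 \<Longrightarrow> a = 0 \<and> b = 0 \<and> c = 0"
  by (simp add: indep3_def)

lemma indepD: "indep K x \<Longrightarrow> (\<Sum>i\<in>K. scale (c i) (x i)) = 0 \<Longrightarrow> i \<in> K \<Longrightarrow> c i = 0"
  by (simp add: indep_def)

lemma spannedI: "v = (\<Sum>i\<in>K. scale (c i) (x i)) \<Longrightarrow> spanned K x v"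
  by (auto simp: spanned_def)

lemma indep_mono:
  assumes "indep K x" "J \<subseteq> K" "finite K"
  shows "indep J x"
  unfolding indep_def
proof (intro allI impI ballI)
  fix c i assume c: "(\<Sum>i\<in>J. scale (c i) (x i)) = 0" and i: "i \<in> J"
  have "(\<Sum>i\<in>K. scale (if i \<in> J then c i else 0) (x i)) = (\<Sum>i\<in>J. scale (c i) (x i))"
    using assms(2,3) by (intro sum.mono_neutral_cong_right) auto
  then show "c i = 0"
    using indepD[OF assms(1), of "\<lambda>i. if i \<in> J then c i else 0" i] c i assms(2) by auto
qed

lemma indep_coeffs_eq:
  assumes "indep K x" "(\<Sum>i\<in>K. scale (a i) (x i)) = (\<Sum>i\<in>K. scale (b i) (x i))" "i \<in> K"
  shows "a i = b i"
proof -
  have "(\<Sum>i\<in>K. scale (a i - b i) (x i)) = 0"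
    using assms(2) by (simp add: scale_diff_left sum_subtractf)
  then have "a i - b i = 0" using indepD[OF assms(1), of "\<lambda>i. a i - b i"] assms(3) by simp
  then show ?thesis by simp
qed

lemma indep_not_spanned:
  assumes "indep K x" "s \<in> K" "finite K"
  shows "\<not> spanned (K - {s}) x (x s)"
proof
  assume "spanned (K - {s}) x (x s)"
  then obtain c where "x s = (\<Sum>i\<in>K - {s}. scale (c i) (x i))" unfolding spanned_def by blast
  then have "(\<Sum>i\<in>K. scale (if i = s then - 1 else c i) (x i)) = 0"
    using assms(2,3) by (subst sum.remove[of _ s]) (auto simp: scale_minus_left scale_one)
  from indepD[OF assms(1) this assms(2)] show False by simp
qed

text \<open>
  A vanishing coefficient is a membership statement, so it can be transported by automorphisms.
\<close>

lemma spanned_drop: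
  assumes "v = (\<Sum>i\<in>K. scale (c i) (x i))" "c l = 0" "l \<in> K" "finite K"
  shows "spanned (K - {l}) x v"
  by (rule spannedI[where c = c]) (use assms in \<open>simp add: sum.remove[of K l]\<close>)

lemma spanned_reindex:
  assumes p: "bij_betw p K J" and "spanned K (\<lambda>i. x (p i)) v"
  shows "spanned J x v"
proof -
  obtain c where c: "v = (\<Sum>i\<in>K. scale (c i) (x (p i)))" using assms(2) unfolding spanned_def by blast
  also have "\<dots> = (\<Sum>i\<in>K. scale (c (inv_into K p (p i))) (x (p i)))"
    using bij_betw_inv_into_left[OF p] by (intro sum.cong) auto
  also have "\<dots> = (\<Sum>j\<in>J. scale (c (inv_into K p j)) (x j))"
    by (rule sum.reindex_bij_betw[OF p, of "\<lambda>j. scale (c (inv_into K p j)) (x j)"])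
  finally show ?thesis by (rule spannedI)
qed

lemma indep_insert:
  assumes "finite K" "s \<notin> K" "indep K x" "\<not> spanned K x (x s)"
  shows "indep (insert s K) x"
  unfolding indep_def
proof (intro allI impI)
  fix c assume "(\<Sum>i\<in>insert s K. scale (c i) (x i)) = 0"
  then have eq: "scale (c s) (x s) + (\<Sum>i\<in>K. scale (c i) (x i)) = 0"
    using assms(1,2) by simp
  have cs: "c s = 0"
  proof (rule ccontr)
    assume "c s \<noteq> 0"
    then have "x s = scale (inverse (c s)) (scale (c s) (x s))"
      by (simp add: scale_scale scale_one)
    also have "scale (c s) (x s) = - (\<Sum>i\<in>K. scale (c i) (x i))"
      using eq by (simp add: eq_neg_iff_add_eq_0)
    also have "scale (inverse (c s)) \<dots> = (\<Sum>i\<in>K. scale (- (inverse (c s) * c i)) (x i))"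
      by (simp add: scale_minus_right scale_minus_left scale_sum_right scale_scale sum_negf)
    finally have "spanned K x (x s)" by (rule spannedI)
    then show False using assms(4) by blast
  qed
  then have "(\<Sum>i\<in>K. scale (c i) (x i)) = 0" using eq by simp
  then show "\<forall>i\<in>insert s K. c i = 0" using assms(3) cs unfolding indep_def by blast
qed

lemma indep_reindex:
  assumes p: "bij_betw p K J"
  shows "indep K (\<lambda>i. x (p i)) \<longleftrightarrow> indep J x"
proof
  assume K: "indep K (\<lambda>i. x (p i))"
  show "indep J x"
    unfolding indep_def
  proof (intro allI impI ballI)
    fix c j assume "(\<Sum>j\<in>J. scale (c j) (x j)) = 0" "j \<in> J"
    moreover obtain i where "i \<in> K" "j = p i" using p \<open>j \<in> J\<close> by (auto simp: bij_betw_def)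
    ultimately show "c j = 0"
      using indepD[OF K, of "\<lambda>i. c (p i)" i] sum.reindex_bij_betw[OF p, of "\<lambda>j. scale (c j) (x j)"] by simp
  qed
next
  assume J: "indep J x"
  show "indep K (\<lambda>i. x (p i))"
    unfolding indep_def
  proof (intro allI impI ballI)
    fix c i assume c: "(\<Sum>i\<in>K. scale (c i) (x (p i))) = 0" and i: "i \<in> K"
    define d where "d j = c (inv_into K p j)" for j
    have dp: "i \<in> K \<Longrightarrow> d (p i) = c i" for i
      using bij_betw_inv_into_left[OF p] by (simp add: d_def)
    have "(\<Sum>j\<in>J. scale (d j) (x j)) = (\<Sum>i\<in>K. scale (d (p i)) (x (p i)))"
      by (rule sum.reindex_bij_betw[OF p, of "\<lambda>j. scale (d j) (x j)", symmetric])
    also have "\<dots> = 0" using c dp by simp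
    finally show "c i = 0" using indepD[OF J, of d "p i"] dp[OF i] i bij_betw_apply[OF p] by simp
  qed
qed

lemma left_independent_iff_indep:
  assumes "finite B"
  shows "left_independent scale B \<longleftrightarrow> indep B (\<lambda>x. x)"
proof
  assume "indep B (\<lambda>x. x)"
  then have "indep T (\<lambda>x. x)" if "T \<subseteq> B" for T using indep_mono that assms by blast
  then show "left_independent scale B" unfolding left_independent_def indep_def by blast
qed (use assms in \<open>auto simp: left_independent_def indep_def\<close>)

lemma indep_inj_on:
  assumes "indep K x" "finite K"
  shows "inj_on x K"
proof (rule inj_onI, rule ccontr)
  fix i j assume ij: "i \<in> K" "j \<in> K" "x i = x j" "i \<noteq> j"
  have "indep {i, j} x" using assms ij indep_mono[of K x "{i, j}"] by simp
  from indepD[OF this, of "\<lambda>k. if k = i then 1 else - 1" i] show False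
    using ij by (simp add: scale_minus_left)
qed

section \<open>Frames and the transitivity of the linear group\<close>

text \<open>
  An ordered basis of the whole space.  The ordering makes the pair of two frames the same thing as an
  automorphism (lemma \<open>frame_automorphism\<close> below).
\<close>

definition frame :: "nat \<Rightarrow> (nat \<Rightarrow> 'b) \<Rightarrow> bool" where
  "frame n e \<longleftrightarrow> indep {..<n} e \<and> (\<forall>v. spanned {..<n} e v)"

lemma frame_nonzero: "frame n e \<Longrightarrow> i < n \<Longrightarrow> e i \<noteq> 0"
proof
  assume "frame n e" "i < n" "e i = 0"
  then have "indep {i} e" using indep_mono[of "{..<n}" e "{i}"] by (auto simp: frame_def)
  then show False using \<open>e i = 0\<close> indepD[of "{i}" e "\<lambda>_. 1" i] by simp
qed

lemma frame_indep2:
  assumes "frame n e" "i < n" "j < n" "i \<noteq> j"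
  shows "indep2 (e i) (e j)"
proof -
  have ind: "indep {i, j} e" using assms indep_mono[of "{..<n}" e "{i, j}"] by (auto simp: frame_def)
  show ?thesis
    unfolding indep2_def
  proof (intro allI impI)
    fix a b assume "scale a (e i) + scale b (e j) = 0"
    then show "a = 0 \<and> b = 0"
      using indepD[OF ind, of "\<lambda>k. if k = i then a else b" i]
        indepD[OF ind, of "\<lambda>k. if k = i then a else b" j] assms by auto
  qed
qed

lemma indep3_of_indep:
  assumes "indep {i, j, k} e" "i \<noteq> j" "i \<noteq> k" "j \<noteq> k"
  shows "indep3 (e i) (e j) (e k)"
  unfolding indep3_def
proof (intro allI impI)
  fix a b c assume eq: "scale a (e i) + scale b (e j) + scale c (e k) = 0"
  define d where "d m = (if m = i then a else if m = j then b else c)" for m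
  have "(\<Sum>m\<in>{i, j, k}. scale (d m) (e m)) = 0"
    using assms eq by (simp add: d_def add.assoc)
  from indepD[OF assms(1) this] have "d i = 0" "d j = 0" "d k = 0" by auto
  then show "a = 0 \<and> b = 0 \<and> c = 0" using assms by (simp add: d_def)
qed

lemma frame_reindex:
  assumes "frame n e" and p: "bij_betw p {..<n} {..<n}"
  shows "frame n (\<lambda>i. e (p i))"
proof -
  define q where "q = inv_into {..<n} p"
  have q: "i < n \<Longrightarrow> q i < n" "i < n \<Longrightarrow> p (q i) = i" "i < n \<Longrightarrow> q (p i) = i" for i
    using p bij_betw_inv_into_right[OF p] bij_betw_inv_into_left[OF p]
      bij_betw_apply[OF bij_betw_inv_into[OF p]]
    by (auto simp: q_def)
  have qp: "(\<Sum>i<n. scale (c i) (e (p i))) = (\<Sum>i<n. scale (c (q i)) (e i))" for c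
    using sum.reindex_bij_betw[OF p, of "\<lambda>i. scale (c (q i)) (e i)"] q by simp
  have "spanned {..<n} (\<lambda>i. e (p i)) v" for v
  proof -
    obtain c where "v = (\<Sum>i<n. scale (c i) (e i))"
      using assms(1) unfolding frame_def spanned_def by blast
    then have "v = (\<Sum>i<n. scale (c (p i)) (e (p i)))" using q unfolding qp by simp
    then show ?thesis by (rule spannedI)
  qed
  moreover have "indep {..<n} (\<lambda>i. e (p i))"
    unfolding indep_def
  proof (intro allI impI ballI)
    fix c i assume "(\<Sum>i<n. scale (c i) (e (p i))) = 0" and i: "i \<in> {..<n}"
    then have "c (q (p i)) = 0"
      using assms(1) indepD[of "{..<n}" e "\<lambda>i. c (q i)" "p i"] bij_betw_apply[OF p, of i]
      unfolding qp frame_def by auto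
    then show "c i = 0" using q(3)[of i] i by simp
  qed
  ultimately show ?thesis by (simp add: frame_def)
qed

lemma frame_swap:
  assumes "frame n e" "i < n" "j < n"
  shows "frame n (e(i := e j, j := e i))"
proof -
  have "bij_betw (id(i := j, j := i)) {..<n} {..<n}"
    using assms(2,3) by (intro bij_betwI[where g = "id(i := j, j := i)"]) auto
  from frame_reindex[OF assms(1) this] show ?thesis
    by (rule back_subst[of "frame n"]) auto
qed

text \<open>
  The exchange step.  The new vector involves the old one with an invertible coefficient, so each
  family of coefficients over the new frame translates into one over the old frame and back.
\<close>

lemma frame_replace:
  assumes e: "frame n e" and k: "k < n" and x: "x = (\<Sum>i<n. scale (c i) (e i))" and ck: "c k \<noteq> 0"
  shows "frame n (e(k := x))"
proof -
  have eq: "(\<Sum>i<n. scale (d i) ((e(k := x)) i))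
      = (\<Sum>i<n. scale (if i = k then d k * c k else d k * c i + d i) (e i))" for d
  proof -
    have "(\<Sum>i<n. scale (d i) ((e(k := x)) i)) = scale (d k) x + (\<Sum>i\<in>{..<n}-{k}. scale (d i) (e i))"
      using k by (subst sum.remove[of _ k]) auto
    also have "scale (d k) x = scale (d k * c k) (e k) + (\<Sum>i\<in>{..<n}-{k}. scale (d k * c i) (e i))"
      unfolding x scale_sum_right scale_scale using k by (subst sum.remove[of _ k]) auto
    also have "scale (d k * c k) (e k) + (\<Sum>i\<in>{..<n}-{k}. scale (d k * c i) (e i))
        + (\<Sum>i\<in>{..<n}-{k}. scale (d i) (e i))
      = scale (d k * c k) (e k) + (\<Sum>i\<in>{..<n}-{k}. scale (d k * c i + d i) (e i))"
      by (simp add: scale_left_distrib sum.distrib add.assoc)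
    also have "\<dots> = (\<Sum>i<n. scale (if i = k then d k * c k else d k * c i + d i) (e i))"
      using k by (subst (2) sum.remove[of _ k]) auto
    finally show ?thesis .
  qed
  have "indep {..<n} (e(k := x))"
    unfolding indep_def
  proof (intro allI impI)
    fix d assume "(\<Sum>i<n. scale (d i) ((e(k := x)) i)) = 0"
    then have *: "i < n \<Longrightarrow> (if i = k then d k * c k else d k * c i + d i) = 0" for i
      using e indepD[of "{..<n}" e "\<lambda>i. if i = k then d k * c k else d k * c i + d i" i]
      unfolding eq frame_def by auto
    have "d k = 0" using *[of k] k ck by simp
    then show "\<forall>i\<in>{..<n}. d i = 0" using * by (metis add_0 lessThan_iff mult_zero_left)
  qed
  moreover have "spanned {..<n} (e(k := x)) v" for v
  proof -
    obtain y where y: "v = (\<Sum>i<n. scale (y i) (e i))"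
      using e unfolding frame_def spanned_def by blast
    define d where "d i = (if i = k then y k * inverse (c k) else y i - y k * inverse (c k) * c i)" for i
    have "(if i = k then d k * c k else d k * c i + d i) = y i" for i
      using ck by (simp add: d_def mult.assoc)
    then have "v = (\<Sum>i<n. scale (d i) ((e(k := x)) i))" unfolding eq y by presburger
    then show ?thesis by (rule spannedI)
  qed
  ultimately show ?thesis by (simp add: frame_def)
qed

lemma frame_add:
  assumes e: "frame n e" and "i < n" "j < n" "i \<noteq> j" and b: "b \<noteq> 0"
  shows "frame n (e(j := scale a (e i) + scale b (e j)))"
proof (rule frame_replace[OF e \<open>j < n\<close>, where c = "\<lambda>k. if k = i then a else if k = j then b else 0"])
  have "(\<Sum>k<n. scale (if k = i then a else if k = j then b else 0) (e k))
     = (\<Sum>k\<in>{i,j}. scale (if k = i then a else if k = j then b else 0) (e k))"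
    using assms by (intro sum.mono_neutral_right) auto
  then show "scale a (e i) + scale b (e j)
     = (\<Sum>k<n. scale (if k = i then a else if k = j then b else 0) (e k))"
    using assms by simp
qed (use assms in auto)

text \<open>
  Steinitz exchange, which also shows that an independent family of \<open>n\<close> vectors is itself a frame.
  The next vector has a nonzero coefficient at some index not yet used up, since otherwise it would
  depend on its predecessors; it is exchanged in at that index, which is then swapped into place.
\<close>

lemma frame_extend:
  assumes "frame n e0" "indep {..<k} x" "k \<le> n"
  shows "\<exists>e. frame n e \<and> (\<forall>i<k. e i = x i)"
  using assms(2,3)
proof (induction k)
  case 0
  then show ?case using assms(1) by auto
next
  case (Suc k)
  have "indep {..<k} x" using Suc.prems by (auto intro: indep_mono)
  then obtain e where e: "frame n e" "\<forall>i<k. e i = x i" using Suc by auto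
  obtain c where c: "x k = (\<Sum>i<n. scale (c i) (e i))"
    using e unfolding frame_def spanned_def by blast
  have "\<exists>j<n. k \<le> j \<and> c j \<noteq> 0"
  proof (rule ccontr)
    assume "\<not> ?thesis"
    then have "x k = (\<Sum>i<k. scale (c i) (e i))"
      unfolding c using Suc.prems by (intro sum.mono_neutral_right) auto
    then have "(\<Sum>i<Suc k. scale (if i < k then c i else - 1) (x i)) = 0"
      using e by (simp add: scale_minus_left scale_one)
    from indepD[OF Suc.prems(1) this, of k] show False by simp
  qed
  then obtain j where j: "j < n" "k \<le> j" "c j \<noteq> 0" by blast
  have "frame n (e(j := x k))" using frame_replace[OF e(1) j(1) c j(3)] .
  then have "frame n ((e(j := x k))(j := (e(j := x k)) k, k := (e(j := x k)) j))"
    by (rule frame_swap) (use j Suc.prems(2) in auto)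
  moreover have "((e(j := x k))(j := (e(j := x k)) k, k := (e(j := x k)) j)) i = x i" if "i < Suc k" for i
    using that e(2) j by (auto simp: less_Suc_eq)
  ultimately show ?case by blast
qed

lemma frame_of_pair:
  assumes "frame n e0" "2 \<le> n" "indep2 x y"
  obtains e where "frame n e" "e 0 = x" "e 1 = y"
proof -
  have "indep {..<2} ((!) [x, y])"
    using assms(3) by (auto simp: indep2_def indep_def numeral_2_eq_2 less_Suc_eq)
  from frame_extend[OF assms(1) this assms(2)] that show thesis
    by (metis One_nat_def Suc_1 lessI nth_Cons_0 nth_Cons_Suc zero_less_Suc)
qed

lemma frame_of_triple:
  assumes "frame n e0" "3 \<le> n"
    and "indep3 x y z"
  obtains e where "frame n e" "e 0 = x" "e 1 = y" "e 2 = z"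
proof -
  have "indep {..<3} ((!) [x, y, z])"
    using assms(3) by (auto simp: indep3_def indep_def eval_nat_numeral less_Suc_eq)
  from frame_extend[OF assms(1) this assms(2)] obtain e where
    e: "frame n e" "\<forall>i<3. e i = [x, y, z] ! i" by blast
  show thesis using that[OF e(1)] e(2) by (simp add: eval_nat_numeral)
qed

lemma indep_card_le_frame:
  assumes "frame n e0" "indep {..<k} x"
  shows "k \<le> n"
proof (rule ccontr)
  assume "\<not> k \<le> n"
  then have "indep {..<n} x" "n < k" using assms(2) by (auto intro: indep_mono)
  then obtain e where e: "frame n e" "\<forall>i<n. e i = x i" using frame_extend assms(1) by blast
  then obtain c where c: "x n = (\<Sum>i<n. scale (c i) (e i))"
    unfolding frame_def spanned_def by blast
  have "indep {..<Suc n} x" using assms(2) \<open>n < k\<close> by (auto intro: indep_mono)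
  moreover have "(\<Sum>i<Suc n. scale (if i < n then c i else - 1) (x i)) = 0"
    using e c by (simp add: scale_minus_left scale_one)
  ultimately show False using indepD[of "{..<Suc n}" x "\<lambda>i. if i < n then c i else - 1" n] by simp
qed

definition coord :: "nat \<Rightarrow> (nat \<Rightarrow> 'b) \<Rightarrow> 'b \<Rightarrow> nat \<Rightarrow> 'a" where
  "coord n e x = (SOME c. x = (\<Sum>i<n. scale (c i) (e i)))"

lemma coord_expand: "frame n e \<Longrightarrow> x = (\<Sum>i<n. scale (coord n e x i) (e i))"
  unfolding coord_def using someI_ex[of "\<lambda>c. x = (\<Sum>i<n. scale (c i) (e i))"]
  by (simp add: frame_def spanned_def)

lemma coord_unique:
  assumes "frame n e" "x = (\<Sum>i<n. scale (d i) (e i))" "i < n"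
  shows "coord n e x i = d i"
proof (rule indep_coeffs_eq[where x = e])
  show "indep {..<n} e" using assms(1) by (simp add: frame_def)
  show "(\<Sum>i<n. scale (coord n e x i) (e i)) = (\<Sum>i<n. scale (d i) (e i))"
    using coord_expand[OF assms(1), of x] assms(2) by (metis (no_types))
qed (use assms(3) in simp)

lemma coord_add:
  assumes "frame n e" "i < n"
  shows "coord n e (x + y) i = coord n e x i + coord n e y i"
proof (rule coord_unique[OF assms(1) _ assms(2)])
  show "x + y = (\<Sum>i<n. scale (coord n e x i + coord n e y i) (e i))"
    using arg_cong2[of _ _ _ _ "(+)", OF coord_expand[OF assms(1), of x] coord_expand[OF assms(1), of y]]
    by (simp only: scale_left_distrib sum.distrib)
qed

lemma coord_scale:
  assumes "frame n e" "i < n"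
  shows "coord n e (scale a x) i = a * coord n e x i"
proof (rule coord_unique[OF assms(1) _ assms(2)])
  show "scale a x = (\<Sum>i<n. scale (a * coord n e x i) (e i))"
    using arg_cong[of _ _ "scale a", OF coord_expand[OF assms(1), of x]]
    by (simp only: scale_scale scale_sum_right)
qed

lemma coord_frame:
  assumes "frame n e" "i < n" "j < n"
  shows "coord n e (e j) i = (if i = j then 1 else 0)"
proof (rule coord_unique[OF assms(1) _ assms(2)])
  show "e j = (\<Sum>i<n. scale (if i = j then 1 else 0) (e i))"
    using assms(3) by (subst sum.remove[of _ j]) (auto simp: scale_one)
qed

text \<open>
  Keeping coordinates and changing the frame is linear and has an inverse of the same kind.
\<close>

lemma frame_automorphism:
  assumes e: "frame n e" and g: "frame n g"
  obtains u where "linear_automorphism scale u" "\<And>i. i < n \<Longrightarrow> u (e i) = g i"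
proof -
  define u where "u x = (\<Sum>i<n. scale (coord n e x i) (g i))" for x
  have add: "u (x + y) = u x + u y" for x y
    by (simp add: u_def coord_add[OF e] scale_left_distrib sum.distrib)
  have hom: "u (scale a x) = scale a (u x)" for a x
    by (simp add: u_def coord_scale[OF e] scale_sum_right scale_scale)
  have ker: "x = 0" if "u x = 0" for x
  proof -
    have "i < n \<Longrightarrow> coord n e x i = 0" for i
      using that g indepD[of "{..<n}" g "coord n e x" i] unfolding u_def frame_def by simp
    then show ?thesis by (subst coord_expand[OF e, of x]) simp
  qed
  have "inj u"
  proof (rule injI)
    fix x y assume "u x = u y"
    then have "u (x - y) = 0" using add[of "x - y" y] by simp
    then show "x = y" using ker[of "x - y"] by simp
  qed
  moreover have "surj u"
    unfolding surj_def
  proof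
    fix v
    obtain d where "v = (\<Sum>i<n. scale (d i) (g i))"
      using g unfolding frame_def spanned_def by blast
    then have "v = u (\<Sum>i<n. scale (d i) (e i))" by (simp add: u_def coord_unique[OF e])
    then show "\<exists>x. v = u x" by blast
  qed
  ultimately have "bij u" by (simp add: bij_def)
  moreover have "u (e j) = g j" if "j < n" for j
    unfolding u_def using that by (subst sum.remove[of _ j]) (auto simp: coord_frame[OF e] scale_one)
  ultimately show thesis using that add hom unfolding linear_automorphism_def by blast
qed

text \<open>
  The combinations of a basis \<open>B\<close> form a subspace containing \<open>B\<close>, hence everything; any enumeration
  of \<open>B\<close> is then a frame.
\<close>

lemma frame_exists_of_dim:
  assumes "has_left_dim scale UNIV n"
  shows "\<exists>e. frame n e"
proof -
  obtain B where B: "finite B" "card B = n" "left_independent scale B" "left_span scale B = UNIV"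
    using assms unfolding has_left_dim_def by blast
  have "left_subspace scale {v. spanned B (\<lambda>x. x) v}"
    unfolding left_subspace_def mem_Collect_eq
  proof (intro conjI ballI allI)
    show "spanned B (\<lambda>x. x) 0" by (rule spannedI[of _ "\<lambda>_. 0"]) simp
  next
    fix v w assume "v \<in> {v. spanned B (\<lambda>x. x) v}" "w \<in> {v. spanned B (\<lambda>x. x) v}"
    then obtain c d where "v = (\<Sum>x\<in>B. scale (c x) x)" "w = (\<Sum>x\<in>B. scale (d x) x)"
      unfolding spanned_def by blast
    then show "spanned B (\<lambda>x. x) (v + w)"
      by (intro spannedI[of _ "\<lambda>x. c x + d x"]) (simp add: scale_left_distrib sum.distrib)
  next
    fix a v assume "v \<in> {v. spanned B (\<lambda>x. x) v}"
    then obtain c where "v = (\<Sum>x\<in>B. scale (c x) x)" unfolding spanned_def by blast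
    then show "spanned B (\<lambda>x. x) (scale a v)"
      by (intro spannedI[of _ "\<lambda>x. a * c x"]) (simp add: scale_sum_right scale_scale)
  qed
  moreover have "B \<subseteq> {v. spanned B (\<lambda>x. x) v}"
  proof
    fix b assume "b \<in> B"
    then have "b = (\<Sum>x\<in>B. scale (if x = b then 1 else 0) x)"
      using B(1) by (subst sum.remove[of _ b]) (auto simp: scale_one)
    then show "b \<in> {v. spanned B (\<lambda>x. x) v}"
      using spannedI[of b "\<lambda>x. if x = b then 1 else 0"] by simp
  qed
  ultimately have span: "spanned B (\<lambda>x. x) v" for v
    using B(4) hull_minimal[of B "{v. spanned B (\<lambda>x. x) v}" "left_subspace scale"]
    unfolding left_span_def by blast
  obtain e where e: "bij_betw e {..<n} B"
    using ex_bij_betw_nat_finite[OF B(1)] B(2) by (auto simp: atLeast0LessThan)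
  have "indep {..<n} e"
    using indep_reindex[OF e, of "\<lambda>x. x"] left_independent_iff_indep[OF B(1)] B(3) by simp
  moreover have "spanned {..<n} e v" for v
  proof -
    obtain c where "v = (\<Sum>x\<in>B. scale (c x) x)" using span unfolding spanned_def by blast
    also have "\<dots> = (\<Sum>i<n. scale (c (e i)) (e i))"
      by (rule sum.reindex_bij_betw[OF e, of "\<lambda>x. scale (c x) x", symmetric])
    finally show ?thesis by (rule spannedI)
  qed
  ultimately show ?thesis by (auto simp: frame_def)
qed

section \<open>Points of the projective space\<close>

definition ray :: "'b \<Rightarrow> 'b set" where
  "ray x = range (\<lambda>a. scale a x)"

lemma mem_ray: "x \<in> ray x"
  using scale_one[of x] by (metis ray_def rangeI)

lemma left_subspace_ray: "left_subspace scale (ray x)"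
  unfolding left_subspace_def ray_def
  by (auto simp: scale_scale simp flip: scale_left_distrib) (metis scale_zero_left rangeI)

lemma ray_subset: "left_subspace scale S \<Longrightarrow> x \<in> S \<Longrightarrow> ray x \<subseteq> S"
  by (auto simp: left_subspace_def ray_def)

lemma left_span_eq_ray:
  assumes "x \<in> S" "S \<subseteq> ray x"
  shows "left_span scale S = ray x"
  unfolding left_span_def
  using assms ray_subset left_subspace_ray by (intro hull_unique) blast+

lemma ray_scale:
  assumes "a \<noteq> 0"
  shows "ray (scale a x) = ray x"
proof
  show "ray (scale a x) \<subseteq> ray x" by (rule ray_subset[OF left_subspace_ray]) (auto simp: ray_def)
  have "x = scale (inverse a) (scale a x)" using assms by (simp add: scale_scale scale_one)
  then have "x \<in> ray (scale a x)" unfolding ray_def by blast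
  then show "ray x \<subseteq> ray (scale a x)" by (rule ray_subset[OF left_subspace_ray])
qed

lemma proj_points_eq: "proj_points scale = {ray x | x. x \<noteq> 0}"
proof (intro set_eqI iffI)
  fix P assume "P \<in> proj_points scale"
  then obtain B where B: "finite B" "card B = 1" "left_independent scale B" "left_span scale B = P"
    unfolding proj_points_def has_left_dim_def by blast
  then obtain x where x: "B = {x}" by (meson card_1_singletonE)
  have "x \<noteq> 0"
    using B(3) indepD[of B "\<lambda>x. x" "\<lambda>_. 1" x] left_independent_iff_indep[OF B(1)] x by auto
  moreover have "P = ray x" using B(4) left_span_eq_ray[of x B] mem_ray x by auto
  ultimately show "P \<in> {ray x | x. x \<noteq> 0}" by blast
next
  fix P assume "P \<in> {ray x | x. x \<noteq> 0}"
  then obtain x where x: "x \<noteq> 0" "P = ray x" by blast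
  have "indep {x} (\<lambda>x. x)" using x by (simp add: indep_def scale_eq_0_iff)
  then have "has_left_dim scale P 1"
    unfolding has_left_dim_def using x left_independent_iff_indep[of "{x}"] left_span_eq_ray[of x "{x}"] mem_ray
    by (intro exI[of _ "{x}"]) auto
  then show "P \<in> proj_points scale" using left_subspace_ray x by (simp add: proj_points_def)
qed

lemma image_ray:
  assumes "linear_automorphism scale u"
  shows "u ` ray x = ray (u x)"
  using assms by (auto simp: linear_automorphism_def ray_def image_iff)

lemma linear_automorphism_nonzero:
  assumes "linear_automorphism scale u" "x \<noteq> 0"
  shows "u x \<noteq> 0"
proof
  assume "u x = 0"
  moreover have "u 0 = 0" using assms(1) unfolding linear_automorphism_def by (metis add_cancel_right_right add_0)
  ultimately have "u x = u 0" by simp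
  then show False using assms unfolding linear_automorphism_def bij_def by (metis injD)
qed

end

section \<open>Equivariant maps: images of independent points\<close>

text \<open>
  The vector form of the problem: \<open>F x\<close> stands for a chosen spanning vector of \<open>f [x]\<close>, so equalities of
  points become equalities up to a scalar.  The bound on the dimension of \<open>V\<^sub>f\<close> appears as the
  impossibility of \<open>n + 1\<close> independent values (\<open>F_small_span\<close>).
\<close>

locale equivariant_lift =
  V: left_vector_space scale + W: left_vector_space scale'
  for scale :: "'a::division_ring \<Rightarrow> 'b::ab_group_add \<Rightarrow> 'b" (infixr "\<cdot>" 75)
    and scale' :: "'c::field \<Rightarrow> 'd::ab_group_add \<Rightarrow> 'd" (infixr "\<odot>" 75) +
  fixes n :: nat and F :: "'b \<Rightarrow> 'd"
  assumes F_nonzero: "x \<noteq> 0 \<Longrightarrow> F x \<noteq> 0"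
    and F_scale: "x \<noteq> 0 \<Longrightarrow> a \<noteq> 0 \<Longrightarrow> \<exists>c. F (a \<cdot> x) = c \<odot> F x"
    and F_equivariant: "linear_automorphism scale u \<Longrightarrow>
      \<exists>\<phi>. linear_automorphism scale' \<phi> \<and> (\<forall>x. x \<noteq> 0 \<longrightarrow> (\<exists>c. \<phi> (F x) = c \<odot> F (u x)))"
    and F_nonconstant: "\<exists>x y. x \<noteq> 0 \<and> y \<noteq> 0 \<and> (\<forall>c. F x \<noteq> c \<odot> F y)"
    and F_small_span: "(\<And>i. i \<le> n \<Longrightarrow> y i \<noteq> 0) \<Longrightarrow> \<not> W.indep {..n} (\<lambda>i. F (y i))"
    and frame_exists: "\<exists>e. V.frame n e"
    and n_ge_3: "n \<ge> 3"
begin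

text \<open>
  The companion \<open>\<phi>\<close> of \<open>u\<close> acts on the values of \<open>F\<close> with scalars \<open>c x\<close>, which are nonzero because \<open>\<phi>\<close>
  is injective.
\<close>

lemma automorphism_lift:
  assumes "linear_automorphism scale u"
  obtains \<phi> c where "\<And>v w. \<phi> (v + w) = \<phi> v + \<phi> w" "\<And>a v. \<phi> (a \<odot> v) = a \<odot> \<phi> v"
    "\<And>K (g :: 'i \<Rightarrow> 'd). \<phi> (\<Sum>i\<in>K. g i) = (\<Sum>i\<in>K. \<phi> (g i))"
    "\<And>x. x \<noteq> 0 \<Longrightarrow> c x \<noteq> 0" "\<And>x. x \<noteq> 0 \<Longrightarrow> \<phi> (F x) = c x \<odot> F (u x)"
proof -
  obtain \<phi> where \<phi>: "linear_automorphism scale' \<phi>" "\<forall>x. x \<noteq> 0 \<longrightarrow> (\<exists>c. \<phi> (F x) = c \<odot> F (u x))"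
    using F_equivariant[OF assms] by blast
  then have "\<forall>x. \<exists>c. x \<noteq> 0 \<longrightarrow> \<phi> (F x) = c \<odot> F (u x)" by blast
  from choice[OF this] obtain c where c: "\<And>x. x \<noteq> 0 \<Longrightarrow> \<phi> (F x) = c x \<odot> F (u x)" by blast
  have add: "\<phi> (v + w) = \<phi> v + \<phi> w" and hom: "\<phi> (a \<odot> v) = a \<odot> \<phi> v" for v w a
    using \<phi>(1) by (auto simp: linear_automorphism_def)
  have zero: "\<phi> 0 = 0" using hom[of 0 0] by simp
  have "c x \<noteq> 0" if "x \<noteq> 0" for x
  proof
    assume "c x = 0"
    then have "\<phi> (F x) = \<phi> 0" using c[OF that] zero by simp
    then have "F x = 0" using \<phi>(1) unfolding linear_automorphism_def bij_def by (metis injD)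
    then show False using F_nonzero[OF that] by simp
  qed
  moreover have "\<phi> (\<Sum>i\<in>K. g i) = (\<Sum>i\<in>K. \<phi> (g i))" for K and g :: "'i \<Rightarrow> 'd"
    by (induction K rule: infinite_finite_induct) (auto simp: add zero)
  ultimately show thesis using that add hom c by blast
qed

lemma spanned_transport:
  fixes K :: "'i set"
  assumes u: "linear_automorphism scale u" and "x \<noteq> 0" "\<And>i. i \<in> K \<Longrightarrow> y i \<noteq> 0"
    and "W.spanned K (\<lambda>i. F (y i)) (F x)"
  shows "W.spanned K (\<lambda>i. F (u (y i))) (F (u x))"
proof -
  from assms(4) obtain d where d: "F x = (\<Sum>i\<in>K. d i \<odot> F (y i))" unfolding W.spanned_def by blast
  obtain \<phi> c where \<phi>: "\<And>v w. \<phi> (v + w) = \<phi> v + \<phi> w" "\<And>a v. \<phi> (a \<odot> v) = a \<odot> \<phi> v"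
    "\<And>K (g :: 'i \<Rightarrow> 'd). \<phi> (\<Sum>i\<in>K. g i) = (\<Sum>i\<in>K. \<phi> (g i))"
    "\<And>x. x \<noteq> 0 \<Longrightarrow> c x \<noteq> 0" "\<And>x. x \<noteq> 0 \<Longrightarrow> \<phi> (F x) = c x \<odot> F (u x)"
    using automorphism_lift[OF u] by metis
  have "F (u x) = inverse (c x) \<odot> \<phi> (F x)"
    using \<phi>(4,5) assms(2) by (simp add: W.scale_scale W.scale_one)
  also have "\<dots> = (\<Sum>i\<in>K. inverse (c x) \<odot> d i \<odot> \<phi> (F (y i)))"
    unfolding d \<phi> W.scale_sum_right ..
  also have "\<dots> = (\<Sum>i\<in>K. (inverse (c x) * d i * c (y i)) \<odot> F (u (y i)))"
    using \<phi>(5) assms(3) by (intro sum.cong) (auto simp: W.scale_scale mult.assoc)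
  finally show ?thesis by (rule W.spannedI)
qed

lemma linear_automorphism_add: "linear_automorphism scale u \<Longrightarrow> u (x + y) = u x + u y"
  by (simp add: linear_automorphism_def)

lemma linear_automorphism_scale: "linear_automorphism scale u \<Longrightarrow> u (a \<cdot> x) = a \<cdot> u x"
  by (simp add: linear_automorphism_def)

lemma spanned_transport_frame:
  assumes e: "V.frame n e" and g: "V.frame n g" and s: "s < n" and K: "K \<subseteq> {..<n}"
    and sp: "W.spanned K (\<lambda>i. F (e i)) (F (e s))"
  shows "W.spanned K (\<lambda>i. F (g i)) (F (g s))"
proof -
  obtain u where u: "linear_automorphism scale u" "\<And>i. i < n \<Longrightarrow> u (e i) = g i"
    using V.frame_automorphism[OF e g] by blast
  have "W.spanned K (\<lambda>i. F (u (e i))) (F (u (e s)))"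
    using spanned_transport[OF u(1) _ _ sp] V.frame_nonzero[OF e] s K by auto
  moreover have "(\<Sum>i\<in>K. c i \<odot> F (u (e i))) = (\<Sum>i\<in>K. c i \<odot> F (g i))" for c
    using u(2) K by (intro sum.cong) auto
  ultimately show ?thesis using u(2)[OF s] by (simp add: W.spanned_def)
qed

text \<open>
  If one pair of independent vectors had proportional values, then by transitivity on frames all such
  pairs would; dependent pairs always do, so \<open>f\<close> would be constant.
\<close>

lemma F_inj:
  assumes xy: "V.indep2 x y"
  shows "F x \<noteq> c \<odot> F y"
proof
  assume c: "F x = c \<odot> F y"
  obtain e0 where e0: "V.frame n e0" using frame_exists by blast
  have n2: "2 \<le> n" "0 < n" "Suc 0 < n" using n_ge_3 by auto
  obtain e where e: "V.frame n e" "e 0 = x" "e 1 = y"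
    using V.frame_of_pair[OF e0 n2(1) xy] by blast
  have sp: "W.spanned {1} (\<lambda>i. F (e i)) (F (e 0))"
    unfolding W.spanned_def e using c e by auto
  obtain x' y' where n: "x' \<noteq> 0" "y' \<noteq> 0" and nc: "\<forall>c. F x' \<noteq> c \<odot> F y'"
    using F_nonconstant by blast
  show False
  proof (cases "V.indep2 x' y'")
    case True
    then obtain g where g: "V.frame n g" "g 0 = x'" "g 1 = y'"
      using V.frame_of_pair[OF e0 n2(1)] by metis
    have "W.spanned {1} (\<lambda>i. F (g i)) (F (g 0))"
      using spanned_transport_frame[OF e(1) g(1) _ _ sp] n2 by simp
    then show False using nc g unfolding W.spanned_def by auto
  next
    case False
    then obtain a b where ab: "a \<cdot> x' + b \<cdot> y' = 0" "a \<noteq> 0 \<or> b \<noteq> 0"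
      unfolding V.indep2_def by blast
    have "a \<noteq> 0" using ab n V.scale_eq_0_iff by (metis V.scale_zero_left add_0)
    have "a \<cdot> x' = (- b) \<cdot> y'" using ab by (simp add: V.scale_minus_left eq_neg_iff_add_eq_0)
    then have "x' = (inverse a * (- b)) \<cdot> y'"
      using \<open>a \<noteq> 0\<close> by (metis V.scale_one V.scale_scale left_inverse)
    moreover have "inverse a * (- b) \<noteq> 0" using calculation n by auto
    ultimately show False using F_scale[OF n(2)] nc by metis
  qed
qed

lemma F_frame_inj:
  assumes "V.frame n e" "i < n" "j < n" "i \<noteq> j"
  shows "F (e i) \<noteq> c \<odot> F (e j)"
  using F_inj V.frame_indep2[OF assms] by blast

lemma F_frame_add_neq:
  assumes e: "V.frame n e" and ij: "i < n" "j < n" "i \<noteq> j"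
  shows "F (e i + e j) \<noteq> c \<odot> F (e i)" "F (e i) \<noteq> c \<odot> F (e i + e j)"
proof -
  have f: "V.frame n (e(j := 1 \<cdot> e i + 1 \<cdot> e j))" using V.frame_add[OF e ij] by simp
  show "F (e i + e j) \<noteq> c \<odot> F (e i)" "F (e i) \<noteq> c \<odot> F (e i + e j)"
    using F_frame_inj[OF f, of j i c] F_frame_inj[OF f, of i j c] ij by (auto simp: V.scale_one)
qed

lemma W_pair:
  assumes "\<And>c. w \<noteq> c \<odot> w'" "w' \<noteq> 0" "a \<odot> w + b \<odot> w' = a' \<odot> w + b' \<odot> w'"
  shows "a = a' \<and> b = b'"
proof -
  have eq: "(a - a') \<odot> w = (b' - b) \<odot> w'"
    using assms(3) by (simp add: W.scale_diff_left algebra_simps)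
  have "a = a'"
  proof (rule ccontr)
    assume "a \<noteq> a'"
    then have "w = inverse (a - a') \<odot> (a - a') \<odot> w" by (simp add: W.scale_scale W.scale_one)
    then show False using assms(1) unfolding eq W.scale_scale by blast
  qed
  then show ?thesis using eq assms(2) by (simp add: W.scale_eq_0_iff)
qed

text \<open>
  Suppose that \<open>F (e l)\<close> lies on the line through \<open>F (e i)\<close> and \<open>F (e j)\<close>.  Applying this to the frame
  with \<open>e j\<close> replaced by \<open>e i + e j\<close> puts \<open>F (e i + e j)\<close> on the same line.  The transvection adding
  \<open>e i\<close> to \<open>e l\<close> fixes \<open>e i\<close>, \<open>e j\<close> and \<open>e i + e j\<close>, so its companion fixes three points of this
  line and therefore also the point of \<open>F (e l)\<close>; but it should move it to the point of
  \<open>F (e i + e l)\<close>.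
\<close>

lemma F_triple:
  assumes e: "V.frame n e" and i: "i < n" and j: "j < n" and l: "l < n"
    and d: "i \<noteq> j" "i \<noteq> l" "j \<noteq> l"
  shows "F (e l) \<noteq> \<alpha> \<odot> F (e i) + \<beta> \<odot> F (e j)"
proof
  assume eq: "F (e l) = \<alpha> \<odot> F (e i) + \<beta> \<odot> F (e j)"
  have nz: "F (e i) \<noteq> 0" "F (e j) \<noteq> 0" "e i \<noteq> 0" "e j \<noteq> 0" "e l \<noteq> 0"
    using V.frame_nonzero[OF e] F_nonzero i j l by auto
  define g where "g = e(j := 1 \<cdot> e i + 1 \<cdot> e j)"
  have g: "V.frame n g" unfolding g_def using V.frame_add[OF e i j d(1), of 1 1] by simp
  have gv: "g i = e i" "g j = e i + e j" "g l = e l" using d by (auto simp: g_def V.scale_one)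
  have nz': "e i + e j \<noteq> 0" using V.frame_nonzero[OF g j] gv by simp
  have "W.spanned {i, j} (\<lambda>i. F (e i)) (F (e l))"
    unfolding W.spanned_def eq using d by (intro exI[of _ "\<lambda>k. if k = i then \<alpha> else \<beta>"]) auto
  then have "W.spanned {i, j} (\<lambda>i. F (g i)) (F (g l))"
    using spanned_transport_frame[OF e g l] i j by auto
  then obtain c where "F (g l) = c i \<odot> F (g i) + c j \<odot> F (g j)"
    unfolding W.spanned_def using d by auto
  then have c: "F (e l) = c i \<odot> F (e i) + c j \<odot> F (e i + e j)" using gv by simp
  have "c j \<noteq> 0" using c F_frame_inj[OF e l i] d by (metis W.scale_zero_left add.right_neutral)
  have diff: "F (e l) - c i \<odot> F (e i) = (\<alpha> - c i) \<odot> F (e i) + \<beta> \<odot> F (e j)"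
    unfolding eq W.scale_diff_left by simp
  have "F (e i + e j) = inverse (c j) \<odot> (F (e l) - c i \<odot> F (e i))"
    using \<open>c j \<noteq> 0\<close> unfolding c by (simp add: W.scale_scale W.scale_one)
  also have "\<dots> = (inverse (c j) * (\<alpha> - c i)) \<odot> F (e i) + (inverse (c j) * \<beta>) \<odot> F (e j)"
    unfolding diff by (simp add: W.scale_scale W.scale_right_distrib)
  finally obtain a b where ab: "F (e i + e j) = a \<odot> F (e i) + b \<odot> F (e j)" by blast
  have "b \<noteq> 0" using ab F_frame_add_neq(1)[OF e i j d(1)] by force
  have "a \<noteq> 0"
    using ab F_frame_add_neq(1)[OF e j i] d(1) by (metis W.scale_zero_left add.commute add.right_neutral)
  define g' where "g' = e(l := 1 \<cdot> e i + 1 \<cdot> e l)"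
  have g': "V.frame n g'" unfolding g'_def using V.frame_add[OF e i l d(2), of 1 1] by simp
  have gv': "g' i = e i" "g' j = e j" "g' l = e i + e l" using d by (auto simp: g'_def V.scale_one)
  obtain u where u: "linear_automorphism scale u" "\<And>i. i < n \<Longrightarrow> u (e i) = g' i"
    using V.frame_automorphism[OF e g'] by blast
  obtain \<phi> c where \<phi>: "\<And>v w. \<phi> (v + w) = \<phi> v + \<phi> w" "\<And>a v. \<phi> (a \<odot> v) = a \<odot> \<phi> v"
    "\<And>x. x \<noteq> 0 \<Longrightarrow> c x \<noteq> 0" "\<And>x. x \<noteq> 0 \<Longrightarrow> \<phi> (F x) = c x \<odot> F (u x)"
    using automorphism_lift[OF u(1)] by metis
  have uv: "u (e i) = e i" "u (e j) = e j" "u (e l) = e i + e l" "u (e i + e j) = e i + e j"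
    using u(2) i j l gv' linear_automorphism_add[OF u(1)] by auto
  \<comment> \<open>Both sides are the image of \<open>F (e i + e j)\<close>; as \<open>a\<close> and \<open>b\<close> are nonzero, \<open>\<phi>\<close> acts as a
    single scalar on the line.\<close>
  have "(a * c (e i)) \<odot> F (e i) + (b * c (e j)) \<odot> F (e j)
      = (c (e i + e j) * a) \<odot> F (e i) + (c (e i + e j) * b) \<odot> F (e j)"
    using \<phi>(4)[OF nz'] \<phi>(4)[OF nz(3)] \<phi>(4)[OF nz(4)]
    by (simp add: ab uv \<phi>(1,2) W.scale_scale W.scale_right_distrib)
  from W_pair[OF F_frame_inj[OF e i j d(1)] nz(2) this]
  have "c (e i) = c (e j)" using \<open>a \<noteq> 0\<close> \<open>b \<noteq> 0\<close> by auto
  then have "\<phi> (F (e l)) = c (e i) \<odot> F (e l)"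
    using \<phi>(4)[OF nz(3)] \<phi>(4)[OF nz(4)]
    by (simp add: eq uv \<phi>(1,2) W.scale_scale W.scale_right_distrib mult.commute)
  then have "F (e l) = (inverse (c (e i)) * c (e l)) \<odot> F (e l + e i)"
    using \<phi>(4)[OF nz(5)] \<phi>(3)[OF nz(3)] uv
    by (metis W.scale_one W.scale_scale add.commute left_inverse)
  then show False using F_frame_add_neq(2)[OF e l i] d by blast
qed

text \<open>
  Suppose that \<open>F (e s)\<close> is a combination of the values on \<open>K\<close>, with coefficients \<open>a\<close>.  By transitivity
  the same is true with \<open>e s\<close> replaced by the sum \<open>t\<close> of all \<open>e i\<close> with \<open>i\<close> in \<open>K\<close> or \<open>i = s\<close>; let \<open>b\<close> be the
  coefficients of \<open>F t\<close>.  No coefficient vanishes, by the induction hypothesis \<open>IH\<close>.  Exchanging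
  \<open>e i\<close> and \<open>e j\<close> fixes both \<open>e s\<close> and \<open>t\<close>.  A third index \<open>l\<close> of \<open>K\<close> shows that the companion
  multiplies \<open>F (e s)\<close> and \<open>F t\<close> by the same scalar, and the indices \<open>i\<close> and \<open>j\<close> then give
  \<open>a\<^sub>j b\<^sub>i = b\<^sub>j a\<^sub>i\<close>.  So \<open>F t\<close> and \<open>F (e s)\<close> are proportional, against injectivity.  With only
  two elements in \<open>K\<close> the scalars could differ by a sign, as for the harmonic quadruple on a line; this
  is why triples need the separate argument of \<open>F_triple\<close>.
\<close>

lemma F_not_spanned:
  assumes e: "V.frame n e" and K: "K \<subseteq> {..<n}" and s: "s < n" "s \<notin> K" and card: "card K \<ge> 3"
    and IH: "\<And>g J. V.frame n g \<Longrightarrow> J \<subseteq> {..<n} \<Longrightarrow> card J = card K \<Longrightarrow> W.indep J (\<lambda>i. F (g i))"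
  shows "\<not> W.spanned K (\<lambda>i. F (e i)) (F (e s))"
proof
  assume sp: "W.spanned K (\<lambda>i. F (e i)) (F (e s))"
  have fin: "finite K" using K finite_subset by blast
  have full: "a l \<noteq> 0" if g: "V.frame n g" and a: "F (g s) = (\<Sum>i\<in>K. a i \<odot> F (g i))" and l: "l \<in> K" for g a l
  proof
    assume "a l = 0"
    from W.spanned_drop[OF a this l fin]
    have "W.spanned (insert s (K - {l}) - {s}) (\<lambda>i. F (g i)) (F (g s))" using s by simp
    moreover have "W.indep (insert s (K - {l})) (\<lambda>i. F (g i))"
      using IH[OF g, of "insert s (K - {l})"] K s l fin card by (auto simp: card_Suc_Diff1)
    ultimately show False using W.indep_not_spanned[of "insert s (K - {l})" "\<lambda>i. F (g i)" s] fin by simp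
  qed
  define t where "t = (\<Sum>i\<in>insert s K. e i)"
  have t: "t = (\<Sum>i<n. (if i \<in> insert s K then 1 else 0) \<cdot> e i)"
    unfolding t_def using K s by (intro sum.mono_neutral_cong_left) (auto simp: V.scale_one)
  define g where "g = e(s := t)"
  have g: "V.frame n g" unfolding g_def by (rule V.frame_replace[OF e s(1) t]) simp
  have gK: "i \<in> K \<Longrightarrow> g i = e i" for i using s by (auto simp: g_def)
  have t0: "t \<noteq> 0" using V.frame_nonzero[OF g s(1)] by (simp add: g_def)
  obtain a where a: "F (e s) = (\<Sum>i\<in>K. a i \<odot> F (e i))" using sp unfolding W.spanned_def by blast
  have "W.spanned K (\<lambda>i. F (g i)) (F (g s))"
    using spanned_transport_frame[OF e g s(1) K sp] .
  then obtain b where b: "F (g s) = (\<Sum>i\<in>K. b i \<odot> F (g i))" unfolding W.spanned_def by blast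
  have bt: "F t = (\<Sum>i\<in>K. b i \<odot> F (e i))" using b gK by (simp add: g_def)
  have ratio: "a j * b i = b j * a i" if ij: "i \<in> K" "j \<in> K" "i \<noteq> j" for i j
  proof -
    have "\<not> K \<subseteq> {i, j}"
    proof
      assume "K \<subseteq> {i, j}"
      then have "card K \<le> card {i, j}" by (intro card_mono) auto
      then show False using card ij(3) by simp
    qed
    then obtain l where l: "l \<in> K" "l \<noteq> i" "l \<noteq> j" by blast
    define p where "p = id(i := j, j := i)"
    have pp: "p (p m) = m" for m by (auto simp: p_def)
    have pK: "m \<in> K \<Longrightarrow> p m \<in> K" "m \<in> insert s K \<Longrightarrow> p m \<in> insert s K" for m
      using ij by (auto simp: p_def)
    have bij: "bij_betw p K K" "bij_betw p (insert s K) (insert s K)"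
      using pp pK by (auto intro!: bij_betwI[where g = p])
    have swap: "(e(i := e j, j := e i)) m = e (p m)" for m using ij(3) by (auto simp: p_def)
    have ijn: "i < n" "j < n" using ij K by auto
    obtain u where u: "linear_automorphism scale u" "\<And>m. m < n \<Longrightarrow> u (e m) = e (p m)"
      using V.frame_automorphism[OF e V.frame_swap[OF e ijn]] swap by metis
    obtain \<phi> c where \<phi>: "\<And>v w. \<phi> (v + w) = \<phi> v + \<phi> w" "\<And>a v. \<phi> (a \<odot> v) = a \<odot> \<phi> v"
      "\<And>K (g :: nat \<Rightarrow> 'd). \<phi> (\<Sum>i\<in>K. g i) = (\<Sum>i\<in>K. \<phi> (g i))"
      "\<And>x. x \<noteq> 0 \<Longrightarrow> c x \<noteq> 0" "\<And>x. x \<noteq> 0 \<Longrightarrow> \<phi> (F x) = c x \<odot> F (u x)"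
      using automorphism_lift[OF u(1)] by metis
    have usum: "u (\<Sum>m\<in>M. h m) = (\<Sum>m\<in>M. u (h m))" for M and h :: "nat \<Rightarrow> 'b"
      using linear_automorphism_add[OF u(1)] linear_automorphism_scale[OF u(1), of 0 0]
      by (induction M rule: infinite_finite_induct) auto
    have ut: "u t = t"
    proof -
      have "u t = (\<Sum>m\<in>insert s K. e (p m))"
        unfolding t_def usum using u(2) K s by (intro sum.cong) auto
      also have "\<dots> = t" unfolding t_def by (rule sum.reindex_bij_betw[OF bij(2)])
      finally show ?thesis .
    qed
    have us: "u (e s) = e s" using u(2)[OF s(1)] s(2) ij by (auto simp: p_def)
    have coeff: "a' (p m) * c (e (p m)) = c x * a' m"
      if x: "x \<noteq> 0" "u x = x" "F x = (\<Sum>i\<in>K. a' i \<odot> F (e i))" and m: "m \<in> K" for x a' m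
    proof (rule W.indep_coeffs_eq[where K = K])
      show "W.indep K (\<lambda>i. F (e i))" using IH[OF e K] by simp
      have "(\<Sum>m\<in>K. (c x * a' m) \<odot> F (e m)) = \<phi> (F x)"
        using \<phi>(5)[OF x(1)] x(2,3) by (simp add: W.scale_sum_right W.scale_scale)
      also have "\<dots> = (\<Sum>m\<in>K. a' m \<odot> \<phi> (F (e m)))" unfolding x(3) \<phi>(3) \<phi>(2) ..
      also have "\<dots> = (\<Sum>m\<in>K. (a' (p (p m)) * c (e (p (p m)))) \<odot> F (e (p m)))"
        using u(2) \<phi>(5) V.frame_nonzero[OF e] K
        by (intro sum.cong refl) (auto simp: pp W.scale_scale)
      also have "\<dots> = (\<Sum>m\<in>K. (a' (p m) * c (e (p m))) \<odot> F (e m))"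
        by (rule sum.reindex_bij_betw[OF bij(1), of "\<lambda>m. (a' (p m) * c (e (p m))) \<odot> F (e m)"])
      finally show "(\<Sum>m\<in>K. (a' (p m) * c (e (p m))) \<odot> F (e m)) = (\<Sum>m\<in>K. (c x * a' m) \<odot> F (e m))" ..
    qed (rule m)
    have es0: "e s \<noteq> 0" using V.frame_nonzero[OF e s(1)] .
    have p': "p l = l" "p j = i" using l ij by (auto simp: p_def)
    have "c (e l) = c (e s)"
      using coeff[OF es0 us a l(1)] full[OF e a l(1)] p' by simp
    moreover have "c (e l) = c t"
      using coeff[OF t0 ut bt l(1)] full[OF g b l(1)] p' by simp
    ultimately have st: "c t = c (e s)" by simp
    have "c t * (a j * b i) = (a i * c (e i)) * b i"
      using coeff[OF es0 us a ij(2)] p' by (simp add: st)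
    also have "\<dots> = (b i * c (e i)) * a i" by simp
    also have "\<dots> = c t * (b j * a i)"
      using coeff[OF t0 ut bt ij(2)] p' by simp
    finally have "c t * (a j * b i) = c t * (b j * a i)" .
    then show ?thesis using \<phi>(4)[OF t0] by simp
  qed
  obtain i where i: "i \<in> K" using card by fastforce
  have multiple: "b j = b i * inverse (a i) * a j" if "j \<in> K" for j
  proof (cases "j = i")
    case False
    then have "b j * a i = b i * a j" using ratio[OF i that] by (simp add: mult.commute)
    then show ?thesis using full[OF e a i] by (simp add: field_simps)
  qed (use full[OF e a i] in simp)
  have "F t = (\<Sum>j\<in>K. (b i * inverse (a i)) \<odot> a j \<odot> F (e j))"
    unfolding bt using multiple by (intro sum.cong refl) (simp add: W.scale_scale)
  then have Ft: "F t = (b i * inverse (a i)) \<odot> F (e s)"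
    unfolding a W.scale_sum_right .
  have "V.frame n (e(i := t))"
    by (rule V.frame_replace[OF e _ t]) (use i K in auto)
  from F_frame_inj[OF this, of i s] show False using Ft i K s by auto
qed

lemma F_frame_indep:
  assumes "V.frame n e" "K \<subseteq> {..<n}"
  shows "W.indep K (\<lambda>i. F (e i))"
  using assms
proof (induction "card K" arbitrary: K e)
  case 0
  then show ?case by (metis W.indep_def card_0_eq empty_iff finite_lessThan finite_subset)
next
  case (Suc k)
  have "finite K" using Suc.prems finite_subset by blast
  then obtain s J where J: "K = insert s J" "s \<notin> J" "finite J"
    using Suc.hyps(2) by (metis card_Suc_eq finite_insert)
  then have k: "card J = k" and s: "s < n" and Jn: "J \<subseteq> {..<n}" using Suc.hyps(2) Suc.prems by auto
  have e: "V.frame n e" by fact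
  have "\<not> W.spanned J (\<lambda>i. F (e i)) (F (e s))"
  proof
    assume sp: "W.spanned J (\<lambda>i. F (e i)) (F (e s))"
    then obtain a where a: "F (e s) = (\<Sum>i\<in>J. a i \<odot> F (e i))" unfolding W.spanned_def by blast
    consider "k = 0" | "k = 1" | "k = 2" | "k \<ge> 3" by linarith
    then show False
    proof cases
      case 1
      then show False using a J k F_nonzero V.frame_nonzero[OF e s] by simp
    next
      case 2
      then obtain i where "J = {i}" using k by (metis card_1_singletonE)
      then show False using a F_frame_inj[OF e s] J Jn by auto
    next
      case 3
      then obtain i j where "J = {i, j}" "i \<noteq> j" using k by (metis card_2_iff)
      then show False using a F_triple[OF e _ _ s, of i j "a i" "a j"] J Jn by auto
    next
      case 4
      have "W.indep M (\<lambda>i. F (g i))" if "V.frame n g" "M \<subseteq> {..<n}" "card M = card J" for g M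
        using Suc.hyps(1) k that by simp
      then show False using F_not_spanned[OF e Jn s J(2)] k 4 sp by simp
    qed
  qed
  then show ?case
    unfolding J(1) by (rule W.indep_insert[OF J(3,2) Suc.hyps(1)[OF k[symmetric] e Jn]])
qed

text \<open>
  Here the bound on the dimension of \<open>V\<^sub>f\<close> enters: a further value outside the span of the image of a
  frame would make \<open>n + 1\<close> independent values.
\<close>

lemma F_frame_spanned:
  assumes e: "V.frame n e" and x: "x \<noteq> 0"
  shows "W.spanned {..<n} (\<lambda>i. F (e i)) (F x)"
proof (rule ccontr)
  assume ns: "\<not> ?thesis"
  define g where "g = e(n := x)"
  have cong: "(\<Sum>i<n. c i \<odot> F (g i)) = (\<Sum>i<n. c i \<odot> F (e i))" for c
    by (intro sum.cong) (auto simp: g_def)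
  have "W.indep {..<n} (\<lambda>i. F (g i))" "\<not> W.spanned {..<n} (\<lambda>i. F (g i)) (F (g n))"
    using F_frame_indep[OF e, of "{..<n}"] ns unfolding W.indep_def W.spanned_def cong
    by (simp_all add: g_def)
  then have "W.indep (insert n {..<n}) (\<lambda>i. F (g i))" by (intro W.indep_insert) auto
  moreover have "insert n {..<n} = {..n}" by auto
  moreover have "i \<le> n \<Longrightarrow> g i \<noteq> 0" for i using V.frame_nonzero[OF e, of i] x by (auto simp: g_def)
  ultimately show False using F_small_span[of g] by simp
qed

section \<open>Equivariant maps: images of collinear points\<close>

lemma bij_betw_extend_triple:
  fixes i j l i' j' l' :: nat
  assumes "i < n" "j < n" "l < n" "i \<noteq> j" "i \<noteq> l" "j \<noteq> l"
    and "i' < n" "j' < n" "l' < n" "i' \<noteq> j'" "i' \<noteq> l'" "j' \<noteq> l'"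
  obtains p where "bij_betw p {..<n} {..<n}" "p i = i'" "p j = j'" "p l = l'"
proof -
  have "card ({..<n} - {i, j, l}) = card ({..<n} - {i', j', l'})"
    using assms by (simp add: card_Diff_subset)
  then obtain q where q: "bij_betw q ({..<n} - {i, j, l}) ({..<n} - {i', j', l'})"
    using finite_same_card_bij[of "{..<n} - {i, j, l}" "{..<n} - {i', j', l'}"] by auto
  define p where "p = q(i := i', j := j', l := l')"
  have "bij_betw p ({..<n} - {i, j, l}) ({..<n} - {i', j', l'})"
    using q by (subst bij_betw_cong[of _ p q]) (auto simp: p_def)
  moreover have "bij_betw p {i, j, l} {i', j', l'}"
    using assms by (auto simp: bij_betw_def inj_on_def p_def)
  ultimately have "bij_betw p (({..<n} - {i, j, l}) \<union> {i, j, l}) (({..<n} - {i', j', l'}) \<union> {i', j', l'})"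
    by (rule bij_betw_combine) auto
  moreover have "({..<n} - {i, j, l}) \<union> {i, j, l} = {..<n}" "({..<n} - {i', j', l'}) \<union> {i', j', l'} = {..<n}"
    using assms by auto
  ultimately show thesis using that[of p] assms by (auto simp: p_def)
qed

text \<open>
  The vanishing of one coefficient of \<open>F (e i + e j)\<close> at an index other than \<open>i\<close> and \<open>j\<close> depends neither
  on the frame nor on the indices, since a permutation of a frame is again a frame.
\<close>

lemma F_sum_coeff_transport:
  assumes e: "V.frame n e" and g: "V.frame n g"
    and i: "i < n" "j < n" "l < n" "i \<noteq> j" "i \<noteq> l" "j \<noteq> l"
    and i': "i' < n" "j' < n" "l' < n" "i' \<noteq> j'" "i' \<noteq> l'" "j' \<noteq> l'"
    and sp: "W.spanned ({..<n} - {l}) (\<lambda>m. F (e m)) (F (e i + e j))"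
  shows "W.spanned ({..<n} - {l'}) (\<lambda>m. F (g m)) (F (g i' + g j'))"
proof -
  obtain p where p: "bij_betw p {..<n} {..<n}" "p i = i'" "p j = j'" "p l = l'"
    using bij_betw_extend_triple[OF i i'] by blast
  obtain u where u: "linear_automorphism scale u" "\<And>i. i < n \<Longrightarrow> u (e i) = g (p i)"
    using V.frame_automorphism[OF e V.frame_reindex[OF g p(1)]] by blast
  have "V.frame n (e(j := 1 \<cdot> e i + 1 \<cdot> e j))" using V.frame_add[OF e i(1,2,4)] by simp
  from V.frame_nonzero[OF this i(2)] have nz: "e i + e j \<noteq> 0" by (simp add: V.scale_one)
  have "W.spanned ({..<n} - {l}) (\<lambda>m. F (u (e m))) (F (u (e i + e j)))"
    using spanned_transport[OF u(1) nz _ sp] V.frame_nonzero[OF e] by auto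
  moreover have "(\<Sum>m\<in>{..<n} - {l}. c m \<odot> F (u (e m))) = (\<Sum>m\<in>{..<n} - {l}. c m \<odot> F (g (p m)))" for c
    using u(2) by (intro sum.cong) auto
  ultimately have "W.spanned ({..<n} - {l}) (\<lambda>m. F (g (p m))) (F (g i' + g j'))"
    using u(2) i p linear_automorphism_add[OF u(1)] by (simp add: W.spanned_def)
  moreover have "bij_betw p ({..<n} - {l}) ({..<n} - {l'})"
    using p i(3) bij_betw_DiffI[OF p(1), of "{l}" "{l'}"] by (auto simp: bij_betw_def)
  ultimately show ?thesis using W.spanned_reindex[of p _ _ "\<lambda>m. F (g m)"] by blast
qed

text \<open>
  The automorphism \<open>u\<close> sends \<open>e 2\<close> to \<open>- (e j + e 2)\<close> and fixes the other members of the frame.  It is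
  an involution over every division ring, fixes \<open>e 0 + e 1\<close>, and sends \<open>e j + e 2\<close> to \<open>- e 2\<close>.  Its
  companion is therefore diagonal off the index \<open>2\<close>, with diagonal entries \<open>c (e i)\<close>, and sends
  \<open>F (e 2)\<close> to \<open>\<mu>\<close> times the combination with coefficients \<open>b\<close>.  Let \<open>\<tau>\<close> be its scalar on
  \<open>F (e 0 + e 1)\<close>.  Comparing coefficients for \<open>F (e 0 + e 1)\<close> at \<open>2\<close> gives \<open>\<mu> b\<^sub>2 = \<tau>\<close>; for
  \<open>F (e j + e 2)\<close> at \<open>i\<close> it gives \<open>c (e i) = - \<tau>\<close>, because \<open>b\<^sub>i\<close> is nonzero; and for
  \<open>F (e 0 + e 1)\<close> at \<open>i\<close> it then gives the claim.  The relation determines the coefficients \<open>b\<close> up to a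
  common factor, in the same way for \<open>j = 0\<close> and \<open>j = 1\<close>.
\<close>

lemma F_sum_coeff_relation:
  assumes e: "V.frame n e" and j: "j \<in> {0, 1}"
    and a: "F (e 0 + e 1) = (\<Sum>i<n. a i \<odot> F (e i))" and a2: "a 2 \<noteq> 0"
    and b: "F (e j + e 2) = (\<Sum>i<n. b i \<odot> F (e i))" and b0: "\<And>i. i < n \<Longrightarrow> b i \<noteq> 0"
    and i: "i < n" "i \<noteq> 2"
  shows "a 2 * b i = 2 * b 2 * a i"
proof -
  have j3: "j < n" "j \<noteq> 2" "2 < n" "0 < n" "1 < n" using n_ge_3 j by auto
  define g where "g = e(2 := (- 1) \<cdot> e j + (- 1) \<cdot> e 2)"
  have g: "V.frame n g" unfolding g_def using V.frame_add[OF e j3(1,3,2), of "- 1" "- 1"] by simp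
  have g2: "g 2 = - e j - e 2" by (simp add: g_def V.scale_minus_left V.scale_one)
  obtain u where u: "linear_automorphism scale u" "\<And>i. i < n \<Longrightarrow> u (e i) = g i"
    using V.frame_automorphism[OF e g] by blast
  obtain \<phi> c where \<phi>: "\<And>v w. \<phi> (v + w) = \<phi> v + \<phi> w" "\<And>a v. \<phi> (a \<odot> v) = a \<odot> \<phi> v"
    "\<And>K (g :: nat \<Rightarrow> 'd). \<phi> (\<Sum>i\<in>K. g i) = (\<Sum>i\<in>K. \<phi> (g i))"
    "\<And>x. x \<noteq> 0 \<Longrightarrow> c x \<noteq> 0" "\<And>x. x \<noteq> 0 \<Longrightarrow> \<phi> (F x) = c x \<odot> F (u x)"
    using automorphism_lift[OF u(1)] by metis
  have ui: "u (e i) = e i" if "i < n" "i \<noteq> 2" for i using u(2) that by (simp add: g_def)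
  have u01: "u (e 0 + e 1) = e 0 + e 1"
    using linear_automorphism_add[OF u(1)] ui j3 by simp
  have u2: "u (e 2) = - e j - e 2" using u(2) g2 j3 by simp
  have uj2: "u (e j + e 2) = - e 2"
    using linear_automorphism_add[OF u(1)] ui j3 u2 by simp
  have nz: "e i \<noteq> 0" if "i < n" for i using V.frame_nonzero[OF e that] .
  have nz01: "e 0 + e 1 \<noteq> 0" 
    using V.frame_nonzero[OF V.frame_add[OF e, of 0 1 1 1], of 1] j3 by (simp add: V.scale_one)
  have nzj2: "e j + e 2 \<noteq> 0" using V.frame_nonzero[OF g, of 2] g2 j3
    by (metis add.commute add_diff_cancel_left' diff_0 minus_add_distrib neg_equal_0_iff_equal uminus_add_conv_diff)
  obtain r where r: "F (- e j - e 2) = r \<odot> F (e j + e 2)"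
    using F_scale[OF nzj2, of "- 1"] by (auto simp: V.scale_minus_left V.scale_one)
  obtain r' where r': "F (- e 2) = r' \<odot> F (e 2)"
    using F_scale[OF nz[OF j3(3)], of "- 1"] by (auto simp: V.scale_minus_left V.scale_one)
  define \<mu> where "\<mu> = c (e 2) * r"
  have phi2: "\<phi> (F (e 2)) = \<mu> \<odot> (\<Sum>i<n. b i \<odot> F (e i))"
    using \<phi>(5)[OF nz[OF j3(3)]] by (simp add: u2 r b[symmetric] \<mu>_def W.scale_scale)
  have phii: "\<phi> (F (e i)) = c (e i) \<odot> F (e i)" if "i < n" "i \<noteq> 2" for i
    using \<phi>(5)[OF nz[OF that(1)]] ui that by simp
  have phi_sum: "\<phi> (\<Sum>i<n. d i \<odot> F (e i))
      = (\<Sum>i<n. (if i = 2 then d 2 * \<mu> * b 2 else d i * c (e i) + d 2 * \<mu> * b i) \<odot> F (e i))" for d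
  proof -
    have "\<phi> (\<Sum>i<n. d i \<odot> F (e i)) = (\<Sum>i<n. d i \<odot> \<phi> (F (e i)))" by (simp add: \<phi>(2,3))
    also have "\<dots> = d 2 \<odot> \<phi> (F (e 2)) + (\<Sum>i\<in>{..<n}-{2}. d i \<odot> \<phi> (F (e i)))"
      using j3 by (subst sum.remove[of _ 2]) auto
    also have "(\<Sum>i\<in>{..<n}-{2}. d i \<odot> \<phi> (F (e i)))
        = (\<Sum>i<n. (if i = 2 then 0 else d i * c (e i)) \<odot> F (e i))"
      using phii by (intro sum.mono_neutral_cong_left) (auto simp: W.scale_scale)
    also have "d 2 \<odot> \<phi> (F (e 2)) + \<dots>
      = (\<Sum>i<n. (d 2 * \<mu> * b i) \<odot> F (e i) + (if i = 2 then 0 else d i * c (e i)) \<odot> F (e i))"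
      unfolding phi2 by (simp add: W.scale_sum_right W.scale_scale sum.distrib mult.assoc)
    also have "\<dots> = (\<Sum>i<n. (if i = 2 then d 2 * \<mu> * b 2 else d i * c (e i) + d 2 * \<mu> * b i) \<odot> F (e i))"
      by (intro sum.cong) (auto simp: W.scale_left_distrib add.commute)
    finally show ?thesis .
  qed
  have ind: "W.indep {..<n} (\<lambda>i. F (e i))" using F_frame_indep[OF e] by simp
  have "(\<Sum>k<n. (if k = 2 then a 2 * \<mu> * b 2 else a k * c (e k) + a 2 * \<mu> * b k) \<odot> F (e k))
      = (\<Sum>k<n. (c (e 0 + e 1) * a k) \<odot> F (e k))"
    unfolding phi_sum[symmetric] a[symmetric]
    using \<phi>(5)[OF nz01, unfolded u01] by (simp only: a W.scale_sum_right W.scale_scale)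
  from W.indep_coeffs_eq[OF ind this]
  have A: "(if k = 2 then a 2 * \<mu> * b 2 else a k * c (e k) + a 2 * \<mu> * b k) = c (e 0 + e 1) * a k"
    if "k < n" for k using that by blast
  have "(\<Sum>k<n. (if k = 2 then c (e j + e 2) * r' else 0) \<odot> F (e k)) = (c (e j + e 2) * r') \<odot> F (e 2)"
    using j3 by (subst sum.remove[of _ 2]) auto
  then have "(\<Sum>k<n. (if k = 2 then b 2 * \<mu> * b 2 else b k * c (e k) + b 2 * \<mu> * b k) \<odot> F (e k))
      = (\<Sum>k<n. (if k = 2 then c (e j + e 2) * r' else 0) \<odot> F (e k))"
    unfolding phi_sum[symmetric] b[symmetric]
    using \<phi>(5)[OF nzj2] by (simp add: uj2 r' W.scale_scale)
  from W.indep_coeffs_eq[OF ind this]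
  have B: "(if k = 2 then b 2 * \<mu> * b 2 else b k * c (e k) + b 2 * \<mu> * b k)
      = (if k = 2 then c (e j + e 2) * r' else 0)" if "k < n" for k using that by blast
  have t: "\<mu> * b 2 = c (e 0 + e 1)" using A[OF j3(3)] a2 by simp
  have "b i * (c (e i) + b 2 * \<mu>) = 0" using B[OF i(1)] i by (simp add: algebra_simps)
  then have ci: "c (e i) = - c (e 0 + e 1)" using b0[OF i(1)] t by (simp add: eq_neg_iff_add_eq_0 mult.commute)
  have "a i * c (e i) + a 2 * \<mu> * b i = c (e 0 + e 1) * a i" using A[OF i(1)] i by simp
  then have "a 2 * \<mu> * b i = 2 * (\<mu> * b 2) * a i" unfolding t ci by (simp add: algebra_simps)
  then have "\<mu> * (a 2 * b i) = \<mu> * (2 * b 2 * a i)" by (simp add: algebra_simps)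
  moreover have "\<mu> \<noteq> 0" using t \<phi>(4)[OF nz01] by auto
  ultimately show ?thesis by simp
qed

text \<open>
  A nonzero coefficient of \<open>F (e 0 + e 1)\<close> at some index \<open>l\<close> other than \<open>0\<close> and \<open>1\<close> forces all
  coefficients of all \<open>F (e i + e j)\<close> to be nonzero: at the indices \<open>i\<close> and \<open>j\<close> because frames have
  independent values, and elsewhere by \<open>F_sum_coeff_transport\<close>.  Then \<open>F_sum_coeff_relation\<close>, for
  \<open>j = 0\<close> and for \<open>j = 1\<close>, makes \<open>F (e 0 + e 2)\<close> and \<open>F (e 1 + e 2)\<close> proportional.
\<close>

lemma F_line:
  assumes e: "V.frame n e"
  shows "\<exists>a b. F (e 0 + e 1) = a \<odot> F (e 0) + b \<odot> F (e 1)"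
proof -
  have n3: "0 < n" "1 < n" "2 < n" using n_ge_3 by auto
  have nz: "e i + e j \<noteq> 0" if "i < n" "j < n" "i \<noteq> j" for i j
    using V.frame_nonzero[OF V.frame_add[OF e that, of 1 1], of j] that by (simp add: V.scale_one)
  have full: "\<exists>a. F (e i + e j) = (\<Sum>k<n. a k \<odot> F (e k))" if "i < n" "j < n" "i \<noteq> j" for i j
    using F_frame_spanned[OF e nz[OF that]] unfolding W.spanned_def .
  obtain a where a: "F (e 0 + e 1) = (\<Sum>k<n. a k \<odot> F (e k))" using full n3 by fastforce
  have "a l = 0" if l: "l < n" "l \<noteq> 0" "l \<noteq> 1" for l
  proof (rule ccontr)
    assume al: "a l \<noteq> 0"
    have ns: "\<not> W.spanned ({..<n} - {l}) (\<lambda>m. F (e m)) (F (e 0 + e 1))"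
    proof
      assume "W.spanned ({..<n} - {l}) (\<lambda>m. F (e m)) (F (e 0 + e 1))"
      then obtain d where "F (e 0 + e 1) = (\<Sum>k\<in>{..<n} - {l}. d k \<odot> F (e k))"
        unfolding W.spanned_def by blast
      also have "\<dots> = (\<Sum>k<n. (if k = l then 0 else d k) \<odot> F (e k))"
        by (intro sum.mono_neutral_cong_left) auto
      finally have "a l = (if l = l then 0 else d l)"
        unfolding a using W.indep_coeffs_eq[OF F_frame_indep[OF e, of "{..<n}"], of a "\<lambda>k. if k = l then 0 else d k" l]
        l by auto
      then show False using al by simp
    qed
    have nonzero: "d k \<noteq> 0" if ij: "i < n" "j < n" "i \<noteq> j"
      and d: "F (e i + e j) = (\<Sum>k<n. d k \<odot> F (e k))" and k: "k < n" for i j k d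
    proof
      assume dk: "d k = 0"
      have sp: "W.spanned ({..<n} - {k}) (\<lambda>m. F (e m)) (F (e i + e j))"
        using W.spanned_drop[OF d dk] k by simp
      show False
      proof (cases "k = i \<or> k = j")
        case True
        define g where "g = e(k := e i + e j)"
        have g: "V.frame n g"
          using True V.frame_add[OF e ij, of 1 1] V.frame_add[OF e ij(2,1), of 1 1] ij
          by (auto simp: g_def V.scale_one add.commute)
        have "(\<Sum>m\<in>{..<n} - {k}. c m \<odot> F (e m)) = (\<Sum>m\<in>{..<n} - {k}. c m \<odot> F (g m))" for c
          by (intro sum.cong) (auto simp: g_def)
        then have "W.spanned ({..<n} - {k}) (\<lambda>m. F (g m)) (F (g k))"
          using sp unfolding W.spanned_def by (simp add: g_def)
        then show False using W.indep_not_spanned[OF F_frame_indep[OF g order.refl]] k by simp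
      next
        case False
        then show False
          using F_sum_coeff_transport[OF e e ij(1,2) k ij(3) _ _ n3(1,2) l(1) _ _ _ sp] ns l by auto
      qed
    qed
    obtain b where b: "F (e 0 + e 2) = (\<Sum>k<n. b k \<odot> F (e k))" using full n3 by fastforce
    obtain b' where b': "F (e 1 + e 2) = (\<Sum>k<n. b' k \<odot> F (e k))" using full n3 by fastforce
    have b0: "k < n \<Longrightarrow> b k \<noteq> 0" and b0': "k < n \<Longrightarrow> b' k \<noteq> 0" and a2: "a 2 \<noteq> 0" for k
      using nonzero[OF _ _ _ b] nonzero[OF _ _ _ b'] nonzero[OF _ _ _ a] n3 by auto
    have "b k = b 2 * inverse (b' 2) * b' k" if k: "k < n" for k
    proof (cases "k = 2")
      case False
      have "a 2 * b k = 2 * b 2 * a k" "a 2 * b' k = 2 * b' 2 * a k"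
        using F_sum_coeff_relation[OF e _ a a2 b b0 k False] F_sum_coeff_relation[OF e _ a a2 b' b0' k False]
        by auto
      then have "a 2 * (b k * b' 2) = b 2 * (2 * b' 2 * a k)" "2 * b' 2 * a k = a 2 * b' k"
        by (simp_all add: mult.assoc[symmetric])
      then have "a 2 * (b k * b' 2) = a 2 * (b 2 * b' k)" by simp
      then show ?thesis using a2 b0'[OF n3(3)] by (simp add: field_simps)
    qed (use b0'[OF n3(3)] in simp)
    then have "F (e 0 + e 2) = (\<Sum>k<n. (b 2 * inverse (b' 2)) \<odot> b' k \<odot> F (e k))"
      unfolding b by (intro sum.cong) (auto simp: W.scale_scale)
    then have par: "F (e 0 + e 2) = (b 2 * inverse (b' 2)) \<odot> F (e 1 + e 2)"
      unfolding b' W.scale_sum_right .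
    define g where "g = e(0 := 1 \<cdot> e 2 + 1 \<cdot> e 0)"
    have g: "V.frame n g" unfolding g_def using V.frame_add[OF e n3(3,1), of 1 1] by simp
    have g': "V.frame n (g(1 := 1 \<cdot> g 2 + 1 \<cdot> g 1))" using V.frame_add[OF g n3(3,2), of 1 1] by simp
    show False
      using F_frame_inj[OF g' n3(1,2), of "b 2 * inverse (b' 2)"] par
      by (simp add: g_def V.scale_one add.commute)
  qed
  then have "F (e 0 + e 1) = (\<Sum>k\<in>{0, 1}. a k \<odot> F (e k))"
    unfolding a using n3 by (intro sum.mono_neutral_right) auto
  then show ?thesis by auto
qed

end

section \<open>From line-preserving maps to semilinear maps\<close>

text \<open>
  A form of the fundamental theorem of projective geometry for maps that need not be onto.  The linear
  form \<open>t\<close> describes a hyperplane, its kernel, not containing the point of \<open>p\<close>.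
\<close>

locale line_lift =
  V: left_vector_space scale + W: left_vector_space scale'
  for scale :: "'a::division_ring \<Rightarrow> 'b::ab_group_add \<Rightarrow> 'b" (infixr "\<cdot>" 75)
    and scale' :: "'c::field \<Rightarrow> 'd::ab_group_add \<Rightarrow> 'd" (infixr "\<odot>" 75) +
  fixes F :: "'b \<Rightarrow> 'd" and p :: 'b and t :: "'b \<Rightarrow> 'a"
  assumes F_scale: "x \<noteq> 0 \<Longrightarrow> a \<noteq> 0 \<Longrightarrow> \<exists>c. c \<noteq> 0 \<and> F (a \<cdot> x) = c \<odot> F x"
    and F_inj: "V.indep2 x y \<Longrightarrow> F x \<noteq> c \<odot> F y"
    and F_line: "V.indep2 x y \<Longrightarrow> \<exists>a b. F (x + y) = a \<odot> F x + b \<odot> F y"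
    and F_indep3: "V.indep3 x y z \<Longrightarrow> W.indep3 (F x) (F y) (F z)"
    and t_add: "t (x + y) = t x + t y"
    and t_scale: "t (a \<cdot> x) = a * t x"
    and t_p: "t p = 1"
    and kernel_large: "t x = 0 \<Longrightarrow> x \<noteq> 0 \<Longrightarrow> \<exists>z. t z = 0 \<and> V.indep2 x z"
    and kernel_nonzero: "\<exists>x. t x = 0 \<and> x \<noteq> 0"
begin

lemma t_0 [simp]: "t 0 = 0"
  using t_scale[of 0 0] by simp

lemma indep2_p:
  assumes "t x = 0" "x \<noteq> 0"
  shows "V.indep2 p x"
  unfolding V.indep2_def
proof (intro allI impI)
  fix a b assume eq: "a \<cdot> p + b \<cdot> x = 0"
  then have "t (a \<cdot> p + b \<cdot> x) = 0" by simp
  then have "a = 0" using assms(1) by (simp add: t_add t_scale t_p)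
  then show "a = 0 \<and> b = 0" using eq assms(2) by (simp add: V.scale_eq_0_iff)
qed

lemma indep3_p:
  assumes "t x = 0" "t y = 0" "V.indep2 x y"
  shows "V.indep3 p x y"
  unfolding V.indep3_def
proof (intro allI impI)
  fix a b c assume eq: "a \<cdot> p + b \<cdot> x + c \<cdot> y = 0"
  then have "t (a \<cdot> p + b \<cdot> x + c \<cdot> y) = 0" by simp
  then have "a = 0" using assms(1,2) by (simp add: t_add t_scale t_p)
  then show "a = 0 \<and> b = 0 \<and> c = 0" using eq V.indep2D[OF assms(3)] by simp
qed

lemma indep2_nonzero: "V.indep2 x y \<Longrightarrow> x \<noteq> 0" "V.indep2 x y \<Longrightarrow> y \<noteq> 0"
  using V.indep2D[of x y 1 0] V.indep2D[of x y 0 1] by (auto simp: V.scale_one)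

lemma indep2_swap: "V.indep2 x y \<Longrightarrow> V.indep2 y x"
  unfolding V.indep2_def by (metis add.commute)

lemma indep2_add:
  assumes "V.indep2 x y"
  shows "V.indep2 x (k \<cdot> x + y)"
  unfolding V.indep2_def
proof (intro allI impI)
  fix a b assume "a \<cdot> x + b \<cdot> (k \<cdot> x + y) = 0"
  then have "(a + b * k) \<cdot> x + b \<cdot> y = 0"
    by (simp add: V.scale_left_distrib V.scale_right_distrib V.scale_scale add.assoc)
  from V.indep2D[OF assms this] show "a = 0 \<and> b = 0" by auto
qed

lemma indep2_add': "V.indep2 x y \<Longrightarrow> V.indep2 x (x + y)"
  using indep2_add[of x y 1] by (simp add: V.scale_one)

lemma indep2_scale:
  assumes "V.indep2 x y" "k \<noteq> 0"
  shows "V.indep2 (k \<cdot> x) y"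
  unfolding V.indep2_def
proof (intro allI impI)
  fix a b assume "a \<cdot> k \<cdot> x + b \<cdot> y = 0"
  then show "a = 0 \<and> b = 0" using V.indep2D[OF assms(1), of "a * k" b] assms(2) by (simp add: V.scale_scale)
qed

lemma dependent_multiple:
  assumes "\<not> V.indep2 x y" "x \<noteq> 0"
  obtains k where "y = k \<cdot> x"
proof -
  obtain a b where ab: "a \<cdot> x + b \<cdot> y = 0" "a \<noteq> 0 \<or> b \<noteq> 0"
    using assms(1) unfolding V.indep2_def by blast
  have b: "b \<noteq> 0" using ab assms(2) by (metis V.scale_eq_0_iff V.scale_zero_left add.right_neutral)
  have "y = inverse b \<cdot> b \<cdot> y" using b by (simp add: V.scale_scale V.scale_one)
  also have "b \<cdot> y = (- a) \<cdot> x" using ab(1) by (simp add: V.scale_minus_left eq_neg_iff_add_eq_0 add.commute)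
  finally show thesis using that V.scale_scale by metis
qed

text \<open>
  The point of \<open>F (p + x)\<close> lies on the line through those of \<open>F p\<close> and \<open>F x\<close> and differs from both, so
  after scaling it is spanned by \<open>F p + w\<close> with a unique vector \<open>w\<close> in the point of \<open>F x\<close>.
\<close>

lemma lift_exists:
  "\<exists>w. if x = 0 then w = 0 else t x = 0 \<longrightarrow>
     (\<exists>c. c \<noteq> 0 \<and> w = c \<odot> F x) \<and> (\<exists>d. d \<noteq> 0 \<and> F (p + x) = d \<odot> (F p + w))"
proof (cases "x \<noteq> 0 \<and> t x = 0")
  case True
  then have px: "V.indep2 p x" using indep2_p by blast
  obtain \<alpha> \<beta> where eq: "F (p + x) = \<alpha> \<odot> F p + \<beta> \<odot> F x" using F_line[OF px] by blast
  have "V.indep2 p (p + x)" "V.indep2 x (x + p)" using indep2_add' px indep2_swap by blast+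
  then have ne: "F (p + x) \<noteq> \<alpha> \<odot> F p" "F (p + x) \<noteq> \<beta> \<odot> F x"
    using F_inj indep2_swap by (metis, metis add.commute)
  have \<alpha>: "\<alpha> \<noteq> 0" using ne eq by auto
  have \<beta>: "\<beta> \<noteq> 0" using ne eq by auto
  have "F (p + x) = \<alpha> \<odot> (F p + (\<beta> / \<alpha>) \<odot> F x)"
    using \<alpha> by (simp add: eq W.scale_right_distrib W.scale_scale)
  moreover have "\<beta> / \<alpha> \<noteq> 0" using \<alpha> \<beta> by simp
  ultimately have "\<exists>w. (\<exists>c. c \<noteq> 0 \<and> w = c \<odot> F x) \<and> (\<exists>d. d \<noteq> 0 \<and> F (p + x) = d \<odot> (F p + w))"
    using \<alpha> by blast
  then show ?thesis using True by simp
qed auto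

text \<open>
  The semilinear map on the hyperplane \<open>t x = 0\<close>; elsewhere the value is irrelevant.
\<close>

definition lift :: "'b \<Rightarrow> 'd" where
  "lift x = (SOME w. if x = 0 then w = 0 else t x = 0 \<longrightarrow>
     (\<exists>c. c \<noteq> 0 \<and> w = c \<odot> F x) \<and> (\<exists>d. d \<noteq> 0 \<and> F (p + x) = d \<odot> (F p + w)))"

lemma lift_0 [simp]: "lift 0 = 0"
  using someI_ex[OF lift_exists[of 0]] by (simp add: lift_def)

lemma lift_point:
  assumes "t x = 0" "x \<noteq> 0"
  shows "\<exists>c. c \<noteq> 0 \<and> lift x = c \<odot> F x" "\<exists>d. d \<noteq> 0 \<and> F (p + x) = d \<odot> (F p + lift x)"
  using someI_ex[OF lift_exists[of x]] assms unfolding lift_def by simp_all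

lemma F_eq_lift:
  assumes "t x = 0" "x \<noteq> 0"
  shows "\<exists>c. F x = c \<odot> lift x"
proof -
  obtain c where "c \<noteq> 0" "lift x = c \<odot> F x" using lift_point(1)[OF assms] by blast
  then have "F x = inverse c \<odot> lift x" by (simp add: W.scale_scale W.scale_one)
  then show ?thesis by blast
qed

lemma lift_indep3:
  assumes "t x = 0" "t y = 0" "V.indep2 x y"
  shows "W.indep3 (F p) (lift x) (lift y)"
proof -
  obtain c where c: "c \<noteq> 0" "lift x = c \<odot> F x"
    using lift_point(1)[OF assms(1) indep2_nonzero(1)[OF assms(3)]] by blast
  obtain d where d: "d \<noteq> 0" "lift y = d \<odot> F y"
    using lift_point(1)[OF assms(2) indep2_nonzero(2)[OF assms(3)]] by blast
  show ?thesis
    unfolding W.indep3_def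
  proof (intro allI impI)
    fix k a b assume "k \<odot> F p + a \<odot> lift x + b \<odot> lift y = 0"
    then have "k \<odot> F p + (a * c) \<odot> F x + (b * d) \<odot> F y = 0"
      by (simp add: c(2) d(2) W.scale_scale)
    from W.indep3D[OF F_indep3[OF indep3_p[OF assms]] this] show "k = 0 \<and> a = 0 \<and> b = 0"
      using c(1) d(1) by simp
  qed
qed

lemma lift_coeffs:
  assumes "t x = 0" "t y = 0" "V.indep2 x y"
    and "a \<odot> F p + b \<odot> lift x + c \<odot> lift y = a' \<odot> F p + b' \<odot> lift x + c' \<odot> lift y"
  shows "a = a' \<and> b = b' \<and> c = c'"
proof -
  have "(a - a') \<odot> F p + (b - b') \<odot> lift x + (c - c') \<odot> lift y = 0"
    using assms(4) by (simp add: W.scale_diff_left algebra_simps)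
  from W.indep3D[OF lift_indep3[OF assms(1-3)] this] show ?thesis by simp
qed

text \<open>
  The point \<open>[p + x + y]\<close> lies on the line joining \<open>[p + x]\<close> to \<open>[y]\<close> and on the one joining \<open>[p + y]\<close>
  to \<open>[x]\<close>.  The images of these two lines meet only in the point of \<open>F p + lift x + lift y\<close>.  On the
  other hand, this image point is spanned by \<open>F p + lift (x + y)\<close> with \<open>lift (x + y)\<close> on the line of
  \<open>F x\<close> and \<open>F y\<close>, and a comparison of coefficients finishes the argument.
\<close>

lemma lift_add_indep:
  assumes x: "t x = 0" and y: "t y = 0" and ind: "V.indep2 x y"
  shows "lift (x + y) = lift x + lift y"
proof -
  note nz = indep2_nonzero[OF ind]
  have pxy: "V.indep2 (p + x) y" "V.indep2 (p + y) x"
    using V.indep3D[OF indep3_p[OF x y ind], of a a b for a b]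
      V.indep3D[OF indep3_p[OF x y ind], of a b a for a b]
    by (auto simp: V.indep2_def V.scale_right_distrib ac_simps)
  have on_line: "\<exists>r s. F (p + x + y) = r \<odot> (F p + lift x) + s \<odot> lift y"
    if pt: "V.indep2 (p + x) y" "t x = 0" "x \<noteq> 0" "t y = 0" "y \<noteq> 0" for x y
  proof -
    obtain r s where rs: "F (p + x + y) = r \<odot> F (p + x) + s \<odot> F y" using F_line[OF pt(1)] by blast
    obtain d where d: "F (p + x) = d \<odot> (F p + lift x)" using lift_point(2)[OF pt(2,3)] by blast
    obtain c where c: "F y = c \<odot> lift y" using F_eq_lift[OF pt(4,5)] by blast
    show ?thesis unfolding rs d c W.scale_scale by blast
  qed
  obtain r s where rs: "F (p + x + y) = r \<odot> (F p + lift x) + s \<odot> lift y"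
    using on_line[OF pxy(1) x nz(1) y nz(2)] by blast
  obtain r' s' where rs': "F (p + y + x) = r' \<odot> (F p + lift y) + s' \<odot> lift x"
    using on_line[OF pxy(2) y nz(2) x nz(1)] by blast
  have swap: "p + x + y = p + y + x" "p + x + y = p + (x + y)" by (simp_all add: ac_simps)
  have "r \<odot> F p + r \<odot> lift x + s \<odot> lift y = r' \<odot> F p + s' \<odot> lift x + r' \<odot> lift y"
    using rs rs' swap(1) by (simp add: W.scale_right_distrib ac_simps)
  from lift_coeffs[OF x y ind this] have s: "s = r" by simp
  have xy: "t (x + y) = 0" "x + y \<noteq> 0"
    using x y indep2_nonzero(2)[OF indep2_add'[OF ind]] by (simp_all add: t_add)
  obtain d where d: "d \<noteq> 0" "F (p + (x + y)) = d \<odot> (F p + lift (x + y))"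
    using lift_point(2)[OF xy] by blast
  obtain c where c: "lift (x + y) = c \<odot> F (x + y)" using lift_point(1)[OF xy] by blast
  obtain a b where "F (x + y) = a \<odot> F x + b \<odot> F y" using F_line[OF ind] by blast
  moreover obtain a' b' where "F x = a' \<odot> lift x" "F y = b' \<odot> lift y"
    using F_eq_lift[OF x nz(1)] F_eq_lift[OF y nz(2)] by blast
  ultimately have l: "lift (x + y) = (c * a * a') \<odot> lift x + (c * b * b') \<odot> lift y"
    using c by (simp add: W.scale_right_distrib W.scale_scale mult.assoc)
  have "r \<odot> F p + r \<odot> lift x + r \<odot> lift y
      = d \<odot> F p + (d * (c * a * a')) \<odot> lift x + (d * (c * b * b')) \<odot> lift y"
    using rs d(2) unfolding swap(2) s l by (simp add: W.scale_right_distrib W.scale_scale add.assoc)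
  from lift_coeffs[OF x y ind this] have "c * a * a' = 1" "c * b * b' = 1" using d(1) by auto
  then show ?thesis using l by (simp add: W.scale_one)
qed

text \<open>
  Dependent \<open>x\<close> and \<open>y\<close> are separated by a vector \<open>z\<close> of the hyperplane independent of \<open>x\<close>: evaluate
  \<open>lift (x + y + z)\<close> in two ways.
\<close>

lemma lift_add:
  assumes x: "t x = 0" and y: "t y = 0"
  shows "lift (x + y) = lift x + lift y"
proof (cases "V.indep2 x y \<or> x = 0 \<or> y = 0")
  case True
  then show ?thesis using lift_add_indep[OF x y] by auto
next
  case False
  then obtain k where k: "y = k \<cdot> x" using dependent_multiple by blast
  have "k \<noteq> 0" using False k by auto
  obtain z where z: "t z = 0" "V.indep2 x z" using kernel_large x False by blast
  have yz: "V.indep2 y z" "t (y + z) = 0" unfolding k using indep2_scale z y \<open>k \<noteq> 0\<close> by (auto simp: t_add k)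
  have "lift (x + y) + lift z = lift (x + y + z)"
  proof (cases "x + y = 0")
    case False
    have eq: "x + y = (1 + k) \<cdot> x" unfolding k by (simp add: V.scale_left_distrib V.scale_one)
    have "1 + k \<noteq> 0"
    proof
      assume "1 + k = 0"
      then show False using eq False by simp
    qed
    then have "V.indep2 (x + y) z" unfolding eq by (rule indep2_scale[OF z(2)])
    then show ?thesis using lift_add_indep[of "x + y" z] x y z by (simp add: t_add)
  qed simp
  also have "\<dots> = lift x + lift (y + z)"
    using lift_add_indep[OF x yz(2)] indep2_add[OF z(2), of k] by (simp add: k add.assoc)
  also have "lift (y + z) = lift y + lift z" using lift_add_indep[OF y z(1) yz(1)] .
  finally show ?thesis by (simp add: add.assoc[symmetric])
qed

lemma lift_nonzero:
  assumes "t x = 0" "x \<noteq> 0"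
  shows "lift x \<noteq> 0"
proof
  assume "lift x = 0"
  obtain z where z: "t z = 0" "V.indep2 x z" using kernel_large assms by blast
  show False
    using W.indep3D[OF lift_indep3[OF assms(1) z], of 0 1 0] \<open>lift x = 0\<close> by simp
qed

text \<open>
  By construction \<open>lift (a \<cdot> x)\<close> is a multiple of \<open>lift x\<close>.  Additivity on \<open>x + y\<close> shows that the factor is
  the same for independent \<open>x\<close> and \<open>y\<close>, and a third vector takes care of dependent ones.
\<close>

lemma lift_scale_exists:
  "\<exists>\<sigma>. \<forall>a x. t x = 0 \<longrightarrow> lift (a \<cdot> x) = \<sigma> a \<odot> lift x"
proof -
  have multiple: "\<exists>s. lift (a \<cdot> x) = s \<odot> lift x" if tx: "t x = 0" for a x
  proof (cases "a = 0 \<or> x = 0")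
    case False
    then have ax: "t (a \<cdot> x) = 0" "a \<cdot> x \<noteq> 0" and x: "a \<noteq> 0" "x \<noteq> 0"
      using tx by (auto simp: t_scale V.scale_eq_0_iff)
    obtain c where "lift (a \<cdot> x) = c \<odot> F (a \<cdot> x)" using lift_point(1)[OF ax] by blast
    moreover obtain c' where "F (a \<cdot> x) = c' \<odot> F x" using F_scale[OF x(2,1)] by blast
    moreover obtain c'' where "F x = c'' \<odot> lift x" using F_eq_lift[OF tx x(2)] by blast
    ultimately have "lift (a \<cdot> x) = (c * c' * c'') \<odot> lift x" by (metis W.scale_scale mult.assoc)
    then show ?thesis by blast
  qed (auto intro: exI[of _ 0])
  have same: "s = s'" if xy: "V.indep2 x y" "t x = 0" "t y = 0"
    "lift (a \<cdot> x) = s \<odot> lift x" "lift (a \<cdot> y) = s' \<odot> lift y" for a x y s s'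
  proof -
    obtain r where r: "lift (a \<cdot> (x + y)) = r \<odot> lift (x + y)"
      using multiple[of "x + y" a] xy(2,3) by (auto simp: t_add)
    have "lift (a \<cdot> (x + y)) = lift (a \<cdot> x) + lift (a \<cdot> y)"
      using lift_add[of "a \<cdot> x" "a \<cdot> y"] that by (simp add: t_scale V.scale_right_distrib)
    then have "0 \<odot> F p + r \<odot> lift x + r \<odot> lift y = 0 \<odot> F p + s \<odot> lift x + s' \<odot> lift y"
      using r that lift_add[of x y] by (simp add: W.scale_right_distrib)
    from lift_coeffs[OF that(2,3,1) this] show ?thesis by (elim conjE) simp
  qed
  obtain x1 where x1: "t x1 = 0" "x1 \<noteq> 0" using kernel_nonzero by blast
  have "\<forall>a. \<exists>s. lift (a \<cdot> x1) = s \<odot> lift x1" using multiple[OF x1(1)] by blast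
  from choice[OF this] obtain \<sigma> where \<sigma>: "\<And>a. lift (a \<cdot> x1) = \<sigma> a \<odot> lift x1" by blast
  have "lift (a \<cdot> x) = \<sigma> a \<odot> lift x" if x: "t x = 0" for a x
  proof (cases "x = 0")
    case False
    obtain s where s: "lift (a \<cdot> x) = s \<odot> lift x" using multiple[OF x] by blast
    have "s = \<sigma> a"
    proof (cases "V.indep2 x1 x")
      case True
      then show ?thesis using same[OF True x1(1) x \<sigma> s] by simp
    next
      case dep: False
      obtain k where k: "x = k \<cdot> x1" using dependent_multiple[OF dep x1(2)] by blast
      obtain z where z: "t z = 0" "V.indep2 x1 z" using kernel_large x1 by blast
      have "k \<noteq> 0" using False k by auto
      then have "V.indep2 x z" unfolding k by (rule indep2_scale[OF z(2)])
      moreover obtain r where r: "lift (a \<cdot> z) = r \<odot> lift z" using multiple[OF z(1)] by blast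
      ultimately have "s = r" using same[of x z a s r] x z(1) s r by blast
      moreover have "\<sigma> a = r" using same[OF z(2) x1(1) z(1) \<sigma> r] .
      ultimately show ?thesis by simp
    qed
    then show ?thesis using s by simp
  qed simp
  then show ?thesis by blast
qed

text \<open>
  On the hyperplane the map is \<open>lift\<close>, and \<open>p\<close> is sent to \<open>F p\<close>.  Off the hyperplane, \<open>x\<close> is a multiple
  of \<open>p + y\<close> with \<open>y\<close> in the hyperplane, and \<open>F (p + y)\<close> is a multiple of \<open>F p + lift y\<close> by the choice
  of \<open>lift\<close>.
\<close>

theorem semilinear_lift:
  obtains l \<sigma> where "is_ring_hom \<sigma>" "\<And>x y. l (x + y) = l x + l y" "\<And>a x. l (a \<cdot> x) = \<sigma> a \<odot> l x"
    "\<And>x. x \<noteq> 0 \<Longrightarrow> \<exists>c. c \<noteq> 0 \<and> l x = c \<odot> F x"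
proof -
  obtain \<sigma> where \<sigma>: "\<And>a x. t x = 0 \<Longrightarrow> lift (a \<cdot> x) = \<sigma> a \<odot> lift x" using lift_scale_exists by blast
  obtain x1 where x1: "t x1 = 0" "x1 \<noteq> 0" using kernel_nonzero by blast
  have cancel: "r = s" if "r \<odot> lift x1 = s \<odot> lift x1" for r s
  proof -
    have "(r - s) \<odot> lift x1 = 0" using that by (simp add: W.scale_diff_left)
    then show ?thesis using lift_nonzero[OF x1] by (simp add: W.scale_eq_0_iff)
  qed
  have \<sigma>_add: "\<sigma> (a + b) = \<sigma> a + \<sigma> b" for a b
  proof (rule cancel)
    have "\<sigma> (a + b) \<odot> lift x1 = lift (a \<cdot> x1 + b \<cdot> x1)" by (simp add: \<sigma>[OF x1(1), symmetric] V.scale_left_distrib)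
    also have "\<dots> = \<sigma> a \<odot> lift x1 + \<sigma> b \<odot> lift x1"
      using \<sigma> x1 lift_add[of "a \<cdot> x1" "b \<cdot> x1"] by (simp add: t_scale)
    finally show "\<sigma> (a + b) \<odot> lift x1 = (\<sigma> a + \<sigma> b) \<odot> lift x1" by (simp add: W.scale_left_distrib)
  qed
  have \<sigma>_mult: "\<sigma> (a * b) = \<sigma> a * \<sigma> b" for a b
  proof (rule cancel)
    have "\<sigma> (a * b) \<odot> lift x1 = lift (a \<cdot> b \<cdot> x1)" by (simp add: \<sigma>[OF x1(1), symmetric] V.scale_scale)
    also have "\<dots> = \<sigma> a \<odot> \<sigma> b \<odot> lift x1" using \<sigma> x1 by (simp add: t_scale)
    finally show "\<sigma> (a * b) \<odot> lift x1 = (\<sigma> a * \<sigma> b) \<odot> lift x1" by (simp add: W.scale_scale)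
  qed
  have \<sigma>_1: "\<sigma> 1 = 1"
    by (rule cancel) (use \<sigma>[OF x1(1), of 1] in \<open>simp add: V.scale_one W.scale_one\<close>)
  have \<sigma>_0: "\<sigma> 0 = 0" using \<sigma>_add[of 0 0] by (metis add_0 add_cancel_right_right)
  have \<sigma>_inverse: "\<sigma> a * \<sigma> (inverse a) = 1" if "a \<noteq> 0" for a
    using that \<sigma>_mult[of a "inverse a"] \<sigma>_1 by simp
  define h where "h x = x - t x \<cdot> p" for x
  have th: "t (h x) = 0" for x
    using t_add[of "h x" "t x \<cdot> p"] by (simp add: h_def t_scale t_p)
  have h_add: "h (x + y) = h x + h y" for x y
    by (simp add: h_def t_add V.scale_left_distrib)
  have h_scale: "h (a \<cdot> x) = a \<cdot> h x" for a x
    by (simp add: h_def t_scale V.scale_diff_right V.scale_scale)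
  define l where "l x = \<sigma> (t x) \<odot> F p + lift (h x)" for x
  have "l (x + y) = l x + l y" for x y
    using lift_add[OF th[of x] th[of y]]
    by (simp add: l_def t_add h_add \<sigma>_add W.scale_left_distrib ac_simps)
  moreover have "l (a \<cdot> x) = \<sigma> a \<odot> l x" for a x
    by (simp add: l_def t_scale h_scale \<sigma>_mult \<sigma>[OF th] W.scale_right_distrib W.scale_scale)
  moreover have "\<exists>c. c \<noteq> 0 \<and> l x = c \<odot> F x" if x: "x \<noteq> 0" for x
  proof (cases "t x = 0")
    case True
    then have "l x = lift x" by (simp add: l_def h_def \<sigma>_0)
    then show ?thesis using lift_point(1) True x by simp
  next
    case False
    define y where "y = inverse (t x) \<cdot> h x"
    have ty: "t y = 0" by (simp add: y_def t_scale th)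
    have xy: "x = t x \<cdot> (p + y)"
      using False by (simp add: y_def V.scale_right_distrib V.scale_scale V.scale_one) (simp add: h_def)
    have py: "p + y \<noteq> 0" using xy x by auto
    have "h x = t x \<cdot> y" using False by (simp add: y_def V.scale_scale V.scale_one)
    then have l: "l x = \<sigma> (t x) \<odot> (F p + lift y)" using \<sigma>[OF ty] by (simp add: l_def W.scale_right_distrib)
    obtain d where d: "d \<noteq> 0" "F (p + y) = d \<odot> (F p + lift y)"
    proof (cases "y = 0")
      case True
      then show thesis using that[of 1] by (simp add: W.scale_one)
    next
      case False
      then show thesis using that lift_point(2)[OF ty] by blast
    qed
    obtain c where c: "c \<noteq> 0" "F x = c \<odot> F (p + y)" using F_scale[OF py False] xy by metis
    have "\<sigma> (t x) \<noteq> 0" using \<sigma>_inverse[OF False] by auto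
    moreover have "l x = (\<sigma> (t x) * inverse (c * d)) \<odot> F x"
    proof -
      have "inverse (c * d) * (c * d) = 1" using c(1) d(1) by (intro left_inverse) simp
      then have "(\<sigma> (t x) * inverse (c * d)) * (c * d) = \<sigma> (t x)" by (simp only: mult.assoc) simp
      then show ?thesis unfolding l c(2) d(2) W.scale_scale by (simp only:)
    qed
    ultimately show ?thesis using c(1) d(1) by (intro exI[of _ "\<sigma> (t x) * inverse (c * d)"]) simp
  qed
  moreover have "is_ring_hom \<sigma>" using \<sigma>_add \<sigma>_mult \<sigma>_1 by (simp add: is_ring_hom_def)
  ultimately show thesis using that by blast
qed

end

section \<open>The semilinear embedding\<close>

context equivariant_lift
begin

lemma F_line_indep2:
  assumes "V.indep2 x y"
  shows "\<exists>a b. F (x + y) = a \<odot> F x + b \<odot> F y"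
proof -
  obtain e0 where "V.frame n e0" using frame_exists by blast
  then obtain e where "V.frame n e" "e 0 = x" "e 1 = y"
    using V.frame_of_pair[of n e0 x y] assms n_ge_3 by auto
  then show ?thesis using F_line by blast
qed

lemma F_indep3:
  assumes "V.indep3 x y z"
  shows "W.indep3 (F x) (F y) (F z)"
proof -
  obtain e0 where "V.frame n e0" using frame_exists by blast
  then obtain e where e: "V.frame n e" "e 0 = x" "e 1 = y" "e 2 = z"
    using V.frame_of_triple[of n e0 x y z] assms n_ge_3 by auto
  have "W.indep {0, 1, 2} (\<lambda>i. F (e i))" using F_frame_indep[OF e(1)] n_ge_3 by auto
  from W.indep3_of_indep[OF this] show ?thesis using e by simp
qed

text \<open>
  The point is the first vector of a frame and the linear form is the first coordinate.  As \<open>n\<close> is at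
  least \<open>3\<close>, the hyperplane has dimension at least \<open>2\<close>, which gives the room that \<open>kernel_large\<close> asks
  for.
\<close>

lemma F_semilinear:
  obtains l \<sigma> where "is_ring_hom \<sigma>" "\<And>x y. l (x + y) = l x + l y" "\<And>a x. l (a \<cdot> x) = \<sigma> a \<odot> l x"
    "\<And>x. x \<noteq> 0 \<Longrightarrow> \<exists>c. c \<noteq> 0 \<and> l x = c \<odot> F x"
proof -
  obtain e where e: "V.frame n e" using frame_exists by blast
  have n: "0 < n" "1 < n" "2 < n" using n_ge_3 by auto
  define t where "t x = V.coord n e x 0" for x
  have t_add: "t (x + y) = t x + t y" and t_scale: "t (a \<cdot> x) = a * t x" and t_e: "t (e 0) = 1" for x y a
    unfolding t_def by (simp_all add: V.coord_add[OF e] V.coord_scale[OF e] V.coord_frame[OF e] n)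
  interpret line_lift scale scale' F "e 0" t
  proof
    show "\<exists>c. c \<noteq> 0 \<and> F (a \<cdot> x) = c \<odot> F x" if "x \<noteq> 0" "a \<noteq> 0" for x a
    proof -
      have "a \<cdot> x \<noteq> 0" using that by (simp add: V.scale_eq_0_iff)
      then have "F (a \<cdot> x) \<noteq> 0" by (rule F_nonzero)
      moreover obtain c where "F (a \<cdot> x) = c \<odot> F x" using F_scale[OF \<open>x \<noteq> 0\<close> \<open>a \<noteq> 0\<close>] by blast
      ultimately show ?thesis by (intro exI[of _ c]) auto
    qed
    show "\<exists>z. t z = 0 \<and> V.indep2 x z" if x: "t x = 0" "x \<noteq> 0" for x
    proof -
      have "V.indep2 (e 0) x"
        unfolding V.indep2_def
      proof (intro allI impI)
        fix a b assume eq: "a \<cdot> e 0 + b \<cdot> x = 0"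
        have "t (a \<cdot> e 0 + b \<cdot> x) = a" using x t_e by (simp add: t_add t_scale)
        moreover have "t 0 = 0" using t_scale[of 0 0] by simp
        ultimately have "a = 0" using eq by simp
        then show "a = 0 \<and> b = 0" using eq x by (simp add: V.scale_eq_0_iff)
      qed
      then obtain g where g: "V.frame n g" "g 0 = e 0" "g 1 = x"
        using V.frame_of_pair[OF e] n by auto
      have ind: "V.indep3 (g 0) (g 1) (g 2)"
        using g(1) n V.indep_mono[of "{..<n}" g "{0, 1, 2}"] V.indep3_of_indep[of 0 1 2 g]
        by (auto simp: V.frame_def)
      \<comment> \<open>The projection of \<open>g 2\<close> to the hyperplane along \<open>e 0\<close>.\<close>
      define z where "z = g 2 - t (g 2) \<cdot> e 0"
      have "t z = 0" using t_add[of z "t (g 2) \<cdot> e 0"] by (simp add: z_def t_scale t_e)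
      moreover have "V.indep2 x z"
        unfolding V.indep2_def
      proof (intro allI impI)
        fix a b assume "a \<cdot> x + b \<cdot> z = 0"
        moreover have "(- (b * t (g 2))) \<cdot> g 0 + a \<cdot> g 1 + b \<cdot> g 2 = a \<cdot> x + b \<cdot> z"
          unfolding z_def g(2) g(3) by (simp add: V.scale_diff_right V.scale_scale V.scale_minus_left)
        ultimately have "(- (b * t (g 2))) \<cdot> g 0 + a \<cdot> g 1 + b \<cdot> g 2 = 0" by simp
        from V.indep3D[OF ind this] show "a = 0 \<and> b = 0" by simp
      qed
      ultimately show ?thesis by blast
    qed
    show "\<exists>x. t x = 0 \<and> x \<noteq> 0"
      using V.coord_frame[OF e, of 0 1] V.frame_nonzero[OF e, of 1] n by (auto simp: t_def)
  qed (use F_inj F_line_indep2 F_indep3 t_add t_scale t_e in auto)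
  show thesis by (rule semilinear_lift) (rule that)
qed

end

theorem theorem2:
  fixes scale :: "'a::division_ring \<Rightarrow> 'b::ab_group_add \<Rightarrow> 'b"
    and scale' :: "'c::field \<Rightarrow> 'd::ab_group_add \<Rightarrow> 'd"
    and f :: "'b set \<Rightarrow> 'd set"
    and n :: nat
  assumes "left_vector_space scale"
    and "has_left_dim scale UNIV n"
    and "n \<ge> 3"
    and "vector_space scale'"
    and "PGL_mapping scale scale' f"
    and "\<exists>P\<in>proj_points scale. \<exists>Q\<in>proj_points scale. f P \<noteq> f Q"
    and "\<exists>m\<le>n. has_left_dim scale' (proj_span scale' (f ` proj_points scale)) m"
  shows "\<exists>l. strong_semilinear_embedding scale scale' l \<and>
             (\<forall>P\<in>proj_points scale. f P = induced_proj_map scale' l P)"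
proof -
  interpret V: left_vector_space scale by fact
  interpret W': vector_space scale' by fact
  interpret W: left_vector_space scale' by (rule W'.left_vector_space)
  \<comment> \<open>This choice depends only on the point of \<open>x\<close>, so it is constant on nonzero multiples.\<close>
  define F where "F x = (SOME w. w \<noteq> 0 \<and> f (V.ray x) = W.ray w)" for x
  have F: "F x \<noteq> 0" "f (V.ray x) = W.ray (F x)" if "x \<noteq> 0" for x
  proof -
    have "f (V.ray x) \<in> proj_points scale'"
      using assms(5) that unfolding PGL_mapping_def V.proj_points_eq by blast
    then have "\<exists>w. w \<noteq> 0 \<and> f (V.ray x) = W.ray w" unfolding W.proj_points_eq by blast
    from someI_ex[OF this] show "F x \<noteq> 0" "f (V.ray x) = W.ray (F x)" by (simp_all add: F_def)
  qed
  interpret equivariant_lift scale scale' n F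
  proof
    show "F x \<noteq> 0" if "x \<noteq> 0" for x using F that by blast
    show "\<exists>c. F (scale a x) = scale' c (F x)" if "x \<noteq> 0" "a \<noteq> 0" for x a
      using W.scale_one[of "F x"] V.ray_scale[OF that(2), of x] by (metis F_def)
    show "\<exists>\<phi>. linear_automorphism scale' \<phi> \<and> (\<forall>x. x \<noteq> 0 \<longrightarrow> (\<exists>c. \<phi> (F x) = scale' c (F (u x))))"
      if u: "linear_automorphism scale u" for u
    proof -
      have "(\<lambda>P\<in>proj_points scale. u ` P) \<in> PGL scale" using u unfolding PGL_def by blast
      then obtain h' where h': "h' \<in> PGL scale'"
        "\<forall>P\<in>proj_points scale. f ((\<lambda>P\<in>proj_points scale. u ` P) P) = h' (f P)"
        using assms(5) unfolding PGL_mapping_def by blast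
      then obtain \<phi> where \<phi>: "linear_automorphism scale' \<phi>" "h' = (\<lambda>P\<in>proj_points scale'. \<phi> ` P)"
        unfolding PGL_def by blast
      have "\<exists>c. \<phi> (F x) = scale' c (F (u x))" if x: "x \<noteq> 0" for x
      proof -
        have x': "V.ray x \<in> proj_points scale" "W.ray (F x) \<in> proj_points scale'"
          using x F(1)[OF x] by (auto simp: V.proj_points_eq W.proj_points_eq)
        have "f (u ` V.ray x) = h' (f (V.ray x))" using h'(2) x'(1) by force
        then have "W.ray (F (u x)) = W.ray (\<phi> (F x))"
          using x' F(2)[OF x] F(2)[OF V.linear_automorphism_nonzero[OF u x]]
          by (simp add: V.image_ray[OF u] W.image_ray[OF \<phi>(1)] \<phi>(2))
        then have "\<phi> (F x) \<in> W.ray (F (u x))" using W.mem_ray by simp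
        then show ?thesis unfolding W.ray_def by blast
      qed
      then show ?thesis using \<phi>(1) by blast
    qed
    show "\<exists>x y. x \<noteq> 0 \<and> y \<noteq> 0 \<and> (\<forall>c. F x \<noteq> scale' c (F y))"
    proof -
      obtain x y where xy: "x \<noteq> 0" "y \<noteq> 0" "f (V.ray x) \<noteq> f (V.ray y)"
        using assms(6) unfolding V.proj_points_eq by blast
      have "F x \<noteq> scale' c (F y)" for c
      proof
        assume eq: "F x = scale' c (F y)"
        then have "c \<noteq> 0" using F(1)[OF xy(1)] by auto
        then have "W.ray (F x) = W.ray (F y)" unfolding eq by (rule W.ray_scale)
        then show False using xy F(2) by simp
      qed
      then show ?thesis using xy by blast
    qed
    show "\<not> W.indep {..n} (\<lambda>i. F (y i))" if y: "\<And>i. i \<le> n \<Longrightarrow> y i \<noteq> 0" for y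
    proof
      assume ind: "W.indep {..n} (\<lambda>i. F (y i))"
      define S where "S = (\<lambda>i. F (y i)) ` {..n}"
      have inj: "inj_on (\<lambda>i. F (y i)) {..n}" using W.indep_inj_on[OF ind] by simp
      have "W.indep S (\<lambda>x. x)"
        using W.indep_reindex[of "\<lambda>i. F (y i)" "{..n}" S "\<lambda>x. x"] ind inj by (simp add: bij_betw_def S_def)
      then have "W'.independent S"
        using W.left_independent_iff_indep[of S] by (simp add: S_def W'.left_independent_eq)
      moreover obtain B m where B: "m \<le> n" "finite B" "card B = m"
        "left_span scale' B = proj_span scale' (f ` proj_points scale)"
        using assms(7) unfolding has_left_dim_def by blast
      moreover have "S \<subseteq> W'.span B"
      proof
        fix v assume "v \<in> S"
        then obtain i where i: "i \<le> n" "v = F (y i)" unfolding S_def by auto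
        have "V.ray (y i) \<in> proj_points scale" using y i V.proj_points_eq by blast
        moreover have "v \<in> f (V.ray (y i))" using F(2) y i W.mem_ray by simp
        ultimately have "v \<in> proj_span scale' (f ` proj_points scale)" unfolding proj_span_def by blast
        then show "v \<in> W'.span B" using B(4) by (simp add: W'.left_span_eq)
      qed
      ultimately have "card S \<le> m" using W'.independent_span_bound[of B S] by simp
      moreover have "card S = Suc n" using inj by (simp add: S_def card_image)
      ultimately show False using B(1) by simp
    qed
    show "\<exists>e. V.frame n e" using V.frame_exists_of_dim[OF assms(2)] .
    show "n \<ge> 3" by fact
  qed
  obtain l \<sigma> where l: "is_ring_hom \<sigma>" "\<And>x y. l (x + y) = l x + l y" "\<And>a x. l (scale a x) = scale' (\<sigma> a) (l x)"
    and lF: "\<And>x. x \<noteq> 0 \<Longrightarrow> \<exists>c. c \<noteq> 0 \<and> l x = scale' c (F x)"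
    by (rule F_semilinear) blast
  have l_nonzero: "l x \<noteq> 0" if "x \<noteq> 0" for x
    using lF[OF that] F(1)[OF that] by (auto simp: W.scale_eq_0_iff)
  have "inj l"
  proof (rule injI)
    fix x y assume "l x = l y"
    then have "l (x - y) = 0" using l(2)[of "x - y" y] by simp
    then show "x = y" using l_nonzero[of "x - y"] by auto
  qed
  have "left_independent scale' (l ` X)"
    if dim: "has_left_dim scale UNIV n'" and X: "finite X" "card X = n'" "left_independent scale X" for n' X
  proof -
    \<comment> \<open>All dimensions of \<open>V\<close> agree with \<open>n\<close>, so the independent family \<open>X\<close> is a frame, and \<open>l\<close> differs
      from \<open>F\<close> on it by nonzero scalars.\<close>
    obtain e0 e1 where e: "V.frame n e0" "V.frame n' e1"
      using V.frame_exists_of_dim assms(2) dim by blast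
    then have "n' = n" using V.indep_card_le_frame unfolding V.frame_def by (metis order_antisym V.frame_def)
    obtain x where x: "bij_betw x {..<n} X"
      using ex_bij_betw_nat_finite[OF X(1)] X(2) \<open>n' = n\<close> by (auto simp: atLeast0LessThan)
    have "V.indep {..<n} x"
      using V.indep_reindex[OF x, of "\<lambda>x. x"] V.left_independent_iff_indep[OF X(1)] X(3) by simp
    then obtain g where g: "V.frame n g" "\<forall>i<n. g i = x i" using V.frame_extend[OF e(1)] by blast
    have "\<forall>i. \<exists>c. i < n \<longrightarrow> c \<noteq> 0 \<and> l (x i) = scale' c (F (g i))"
      using lF V.frame_nonzero[OF g(1)] g(2) by metis
    from choice[OF this] obtain c where c: "\<And>i. i < n \<Longrightarrow> c i \<noteq> 0 \<and> l (x i) = scale' (c i) (F (g i))"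
      by blast
    have "W.indep {..<n} (\<lambda>i. l (x i))"
      unfolding W.indep_def
    proof (intro allI impI ballI)
      fix d i assume "(\<Sum>i<n. scale' (d i) (l (x i))) = 0" and i: "i \<in> {..<n}"
      then have "(\<Sum>i<n. scale' (d i * c i) (F (g i))) = 0" using c by (simp add: W.scale_scale)
      then have "d i * c i = 0"
        using W.indepD[OF F_frame_indep[OF g(1) order.refl], of "\<lambda>i. d i * c i" i] i by simp
      then show "d i = 0" using c i by simp
    qed
    moreover have "bij_betw (\<lambda>i. l (x i)) {..<n} (l ` X)"
      using x \<open>inj l\<close> by (auto simp: bij_betw_def inj_on_def inj_def)
    ultimately show ?thesis
      using W.indep_reindex[of "\<lambda>i. l (x i)" "{..<n}" "l ` X" "\<lambda>x. x"]
        W.left_independent_iff_indep[of "l ` X"] X(1) by simp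
  qed
  then have "strong_semilinear_embedding scale scale' l"
    unfolding strong_semilinear_embedding_def semilinear_def using l \<open>inj l\<close> by blast
  moreover have "f P = induced_proj_map scale' l P" if P: "P \<in> proj_points scale" for P
  proof -
    obtain x where x: "x \<noteq> 0" "P = V.ray x" using P unfolding V.proj_points_eq by blast
    obtain c where c: "c \<noteq> 0" "l x = scale' c (F x)" using lF[OF x(1)] by blast
    have "l ` P \<subseteq> W.ray (l x)" using l(3) by (auto simp: x(2) V.ray_def W.ray_def)
    moreover have "l x \<in> l ` P" using V.mem_ray x(2) by blast
    ultimately have "induced_proj_map scale' l P = W.ray (l x)"
      unfolding induced_proj_map_def by (intro W.left_span_eq_ray)
    also have "\<dots> = f P" unfolding c(2) W.ray_scale[OF c(1)] using F(2)[OF x(1)] x(2) by simp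
    finally show ?thesis ..
  qed
  ultimately show ?thesis by blast
qed

end
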